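(* Let $n\ge 1$ be an integer and let $M=\{m_1,\ldots,m_k\}$, $k\ge 1$, be a finite subset of $\mathcal{M}_n$. Then $\operatorname{SMT}(M,\mathcal{M})\neq\emptyset$; that is, there exists a graph $G$ on $\mathcal{M}$ connecting $M$ such that $|G|=\operatorname{smt}(M,\mathcal{M})$, where lengths are measured with the Gromov--Hausdorff distance.
   Context: $\mathcal{M}$ is the set of all (nonempty) compact metric spaces considered up to isometry, endowed with the Gromov--Hausdorff distance $d_{GH}$, which is a metric on $\mathcal{M}$. Here $d_{GH}(X,Y)$ is the infimum of all $r$ for which there exist a metric space $Z$ and subsets $X',Y'\subset Z$ isometric to $X$ and $Y$ respectively with Hausdorff distance $d_H(X',Y')\le r$. $\mathcal{M}_n\subset\mathcal{M}$ is the set of all metric spaces containing at most $n$ points. A (simple) graph is a pair $G=(V,E)$ with $V$ a finite set and $E$ a set of $2$-element subsets of $V$. Given a metric space $X$ with distance $|xy|$, a graph on $X$ is a graph $G=(V,E)$ with $V\subset X$. For a finite subset $M\subset X$, a graph $G=(V,E)$ on $X$ connects $M$ if $G$ is connected and $M\subset V$. The length $|e|$ of an edge $e=\{v,w\}$ is the distance $|vw|$ in $X$, and the length $|G|$ of $G$ is the sum of the lengths of all its edges. Define $$\operatorname{smt}(M,X)=\inf\bigl\{|G| : G \text{ is a graph on } X \text{ connecting } M\bigr\},$$ and let $\operatorname{SMT}(M,X)$ be the set of all graphs $G$ on $X$ connecting $M$ with $|G|=\operatorname{smt}(M,X)$ (such graphs are called Steiner minimal trees on $M$). *)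

theory Defs
  imports "HOL-Analysis.Analysis"
begin

section \<open>Isometric metric spaces and the Gromov--Hausdorff distance\<close>

definition isometric :: "'a metric \<Rightarrow> 'b metric \<Rightarrow> bool" where
  "isometric X Y \<longleftrightarrow> (\<exists>f. f ` mspace X = mspace Y \<and>
     (\<forall>x\<in>mspace X. \<forall>y\<in>mspace X. mdist Y (f x) (f y) = mdist X x y))"

text \<open>Only meaningful for bounded nonempty \<open>A\<close>, \<open>B\<close>; otherwise the set
  under the infimum may be empty.\<close>

definition hausdorff_dist :: "'a metric \<Rightarrow> 'a set \<Rightarrow> 'a set \<Rightarrow> real" where
  "hausdorff_dist Z A B = Inf {r. 0 < r \<and>
     A \<subseteq> (\<Union>b\<in>B. mball_of Z b r) \<and> B \<subseteq> (\<Union>a\<in>A. mball_of Z a r)}"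

text \<open>The ambient space \<open>Z\<close> has its points in the type \<^typ>\<open>'a + 'b\<close>. This is no
  restriction: by \<open>gh_ambient_adequate\<close> below, every pair of isometric copies in a metric
  space over any type can be moved to this one without changing the Hausdorff distance.\<close>

definition gh_distance :: "'a metric \<Rightarrow> 'b metric \<Rightarrow> real" where
  "gh_distance X Y = Inf {r. \<exists>(Z :: ('a + 'b) metric) X' Y'.
     X' \<subseteq> mspace Z \<and> Y' \<subseteq> mspace Z \<and>
     isometric (submetric Z X') X \<and> isometric (submetric Z Y') Y \<and>
     hausdorff_dist Z X' Y' \<le> r}"


section \<open>The Gromov--Hausdorff space\<close>

text \<open>A compact metric space has at most continuum many points, so it is isometric to one
  whose points are real numbers (with a metric unrelated to the usual one); see
  \<open>compact_metric_isometric_real\<close> below. Hence isometry classes of metrics of type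
  \<^typ>\<open>real metric\<close> represent all compact metric spaces up to isometry.\<close>

definition compact_metrics :: "real metric set" where
  "compact_metrics = {X. mspace X \<noteq> {} \<and> compact_space (mtopology_of X)}"

definition isometry_rel :: "(real metric \<times> real metric) set" where
  "isometry_rel = {(X, Y). X \<in> compact_metrics \<and> Y \<in> compact_metrics \<and> isometric X Y}"

definition gh_space :: "real metric set set" where
  "gh_space = compact_metrics // isometry_rel"

text \<open>The value does not depend on the representatives, see \<open>gh_dist_class\<close> below.\<close>

definition gh_dist :: "real metric set \<Rightarrow> real metric set \<Rightarrow> real" where
  "gh_dist c c' = (THE r. \<exists>X\<in>c. \<exists>Y\<in>c'. r = gh_distance X Y)"

definition gh_space_le :: "nat \<Rightarrow> real metric set set" where
  "gh_space_le n = {c \<in> gh_space. \<forall>X\<in>c. finite (mspace X) \<and> card (mspace X) \<le> n}"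


section \<open>Graphs and Steiner minimal trees\<close>

text \<open>In this section \<open>S\<close> is the carrier of a metric space and \<open>d\<close> its distance function.\<close>

type_synonym 'a graph = "'a set \<times> 'a set set"

definition graph_on :: "'a set \<Rightarrow> 'a graph \<Rightarrow> bool" where
  "graph_on S G \<longleftrightarrow> (case G of (V, E) \<Rightarrow>
     finite V \<and> V \<subseteq> S \<and> (\<forall>e\<in>E. e \<subseteq> V \<and> card e = 2))"

definition connected_graph :: "'a graph \<Rightarrow> bool" where
  "connected_graph G \<longleftrightarrow> (case G of (V, E) \<Rightarrow>
     \<forall>u\<in>V. \<forall>v\<in>V. (u, v) \<in> {(x, y). {x, y} \<in> E}\<^sup>*)"

definition graph_connects :: "'a set \<Rightarrow> 'a set \<Rightarrow> 'a graph \<Rightarrow> bool" where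
  "graph_connects S M G \<longleftrightarrow> graph_on S G \<and> connected_graph G \<and> M \<subseteq> fst G"

text \<open>Well defined because distance functions are symmetric, see \<open>edge_length_pair\<close>.\<close>

definition edge_length :: "('a \<Rightarrow> 'a \<Rightarrow> real) \<Rightarrow> 'a set \<Rightarrow> real" where
  "edge_length d e = (THE r. \<exists>v w. e = {v, w} \<and> r = d v w)"

definition graph_length :: "('a \<Rightarrow> 'a \<Rightarrow> real) \<Rightarrow> 'a graph \<Rightarrow> real" where
  "graph_length d G = (\<Sum>e\<in>snd G. edge_length d e)"

definition smt :: "'a set \<Rightarrow> ('a \<Rightarrow> 'a \<Rightarrow> real) \<Rightarrow> 'a set \<Rightarrow> real" where
  "smt S d M = Inf {graph_length d G | G. graph_connects S M G}"

definition SMT :: "'a set \<Rightarrow> ('a \<Rightarrow> 'a \<Rightarrow> real) \<Rightarrow> 'a set \<Rightarrow> 'a graph set" where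
  "SMT S d M = {G. graph_connects S M G \<and> graph_length d G = smt S d M}"


section \<open>Adequacy of the encoding\<close>

lemma isometric_refl: "isometric X X"
  unfolding isometric_def by (rule exI[of _ id]) auto

lemma isometric_trans:
  assumes "isometric X Y" "isometric Y Z"
  shows "isometric X Z"
proof -
  obtain f where f: "f ` mspace X = mspace Y"
    "\<forall>x\<in>mspace X. \<forall>y\<in>mspace X. mdist Y (f x) (f y) = mdist X x y"
    using assms(1) unfolding isometric_def by blast
  obtain g where g: "g ` mspace Y = mspace Z"
    "\<forall>x\<in>mspace Y. \<forall>y\<in>mspace Y. mdist Z (g x) (g y) = mdist Y x y"
    using assms(2) unfolding isometric_def by blast
  have "(g \<circ> f) ` mspace X = mspace Z"
    using f(1) g(1) by (metis image_comp)
  moreover have "mdist Z ((g \<circ> f) x) ((g \<circ> f) y) = mdist X x y"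
    if "x \<in> mspace X" "y \<in> mspace X" for x y
    using that f g by (metis comp_apply imageI)
  ultimately show ?thesis
    unfolding isometric_def by blast
qed

lemma isometry_inj:
  assumes "\<forall>x\<in>mspace X. \<forall>y\<in>mspace X. mdist Y (f x) (f y) = mdist X x y"
    and "f ` mspace X = mspace Y"
  shows "inj_on f (mspace X)"
proof (rule inj_onI)
  fix x y assume "x \<in> mspace X" "y \<in> mspace X" "f x = f y"
  then show "x = y"
    using assms by (metis imageI mdist_zero)
qed

lemma isometric_sym:
  assumes "isometric X Y"
  shows "isometric Y X"
proof -
  obtain f where f: "f ` mspace X = mspace Y"
    "\<forall>x\<in>mspace X. \<forall>y\<in>mspace X. mdist Y (f x) (f y) = mdist X x y"
    using assms unfolding isometric_def by blast
  have inj: "inj_on f (mspace X)"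
    using isometry_inj f by blast
  show ?thesis
    unfolding isometric_def
    by (rule exI[of _ "inv_into (mspace X) f"])
       (use f inj in \<open>auto simp: inv_into_image_cancel image_iff f(1)[symmetric]
          inv_into_f_f \<close>)
qed

lemma transport_metric:
  fixes h :: "'a \<Rightarrow> 'b" and Z :: "'a metric"
  assumes h: "inj_on h (mspace Z)"
  obtains W :: "'b metric" where "mspace W = h ` mspace Z"
    and "\<And>x y. x \<in> mspace Z \<Longrightarrow> y \<in> mspace Z \<Longrightarrow> mdist W (h x) (h y) = mdist Z x y"
proof -
  let ?k = "inv_into (mspace Z) h"
  let ?d = "\<lambda>x y. mdist Z (?k x) (?k y)"
  have m: "Metric_space (h ` mspace Z) ?d"
  proof
    show "?d x y = 0 \<longleftrightarrow> x = y" if "x \<in> h ` mspace Z" "y \<in> h ` mspace Z" for x y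
      using that h by (auto simp: mdist_zero)
    show "?d x z \<le> ?d x y + ?d y z"
      if "x \<in> h ` mspace Z" "y \<in> h ` mspace Z" "z \<in> h ` mspace Z" for x y z
      using that by (intro mdist_triangle inv_into_into)
  qed (rule mdist_nonneg mdist_commute)+
  show ?thesis
  proof (rule that)
    show "mspace (metric (h ` mspace Z, ?d)) = h ` mspace Z"
      by (rule Metric_space.mspace_metric[OF m])
    show "mdist (metric (h ` mspace Z, ?d)) (h x) (h y) = mdist Z x y"
      if "x \<in> mspace Z" "y \<in> mspace Z" for x y
      by (simp only: Metric_space.mdist_metric[OF m] inv_into_f_f[OF h] that)
  qed
qed

lemma hausdorff_dist_transport:
  assumes W: "mspace W = h ` C" and C: "C \<subseteq> mspace Z"
    and d: "\<And>x y. x \<in> C \<Longrightarrow> y \<in> C \<Longrightarrow> mdist W (h x) (h y) = mdist Z x y"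
    and AB: "A \<subseteq> C" "B \<subseteq> C"
  shows "hausdorff_dist W (h ` A) (h ` B) = hausdorff_dist Z A B"
proof -
  have *: "h ` A \<subseteq> (\<Union>b\<in>h ` B. mball_of W b r) \<longleftrightarrow> A \<subseteq> (\<Union>b\<in>B. mball_of Z b r)"
    if "A \<subseteq> C" "B \<subseteq> C" for A B r
  proof -
    have "h a \<in> mball_of W (h b) r \<longleftrightarrow> a \<in> mball_of Z b r" if "a \<in> A" "b \<in> B" for a b
    proof -
      have "a \<in> C" "b \<in> C"
        using that \<open>A \<subseteq> C\<close> \<open>B \<subseteq> C\<close> by auto
      then show ?thesis
        using C d by (auto simp: in_mball_of W)
    qed
    then have "(\<forall>a\<in>A. \<exists>b\<in>B. h a \<in> mball_of W (h b) r) \<longleftrightarrow> (\<forall>a\<in>A. \<exists>b\<in>B. a \<in> mball_of Z b r)"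
      by (intro ball_cong bex_cong refl)
    then show ?thesis
      by (simp only: subset_eq ball_simps(9) UN_iff bex_simps(7))
  qed
  show ?thesis
    unfolding hausdorff_dist_def by (simp only: *[OF AB] *[OF AB(2,1)])
qed

lemma gh_ambient_adequate:
  fixes X :: "'a metric" and Y :: "'b metric" and Z :: "'c metric"
  assumes sub: "X' \<subseteq> mspace Z" "Y' \<subseteq> mspace Z"
    and iso: "isometric (submetric Z X') X" "isometric (submetric Z Y') Y"
  obtains W :: "('a + 'b) metric" and X'' Y'' where
    "X'' \<subseteq> mspace W" "Y'' \<subseteq> mspace W"
    "isometric (submetric W X'') X" "isometric (submetric W Y'') Y"
    "hausdorff_dist W X'' Y'' = hausdorff_dist Z X' Y'"
proof -
  have ms: "mspace (submetric Z X') = X'" "mspace (submetric Z Y') = Y'"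
    using sub by auto
  obtain f where f: "f ` X' = mspace X" "\<forall>x\<in>X'. \<forall>y\<in>X'. mdist X (f x) (f y) = mdist Z x y"
    "inj_on f X'"
    using iso(1) isometry_inj[of "submetric Z X'" X] ms unfolding isometric_def
    by (metis mdist_submetric)
  obtain g where g: "g ` Y' = mspace Y" "\<forall>x\<in>Y'. \<forall>y\<in>Y'. mdist Y (g x) (g y) = mdist Z x y"
    "inj_on g Y'"
    using iso(2) isometry_inj[of "submetric Z Y'" Y] ms unfolding isometric_def
    by (metis mdist_submetric)
  define h where "h z = (if z \<in> X' then Inl (f z) else Inr (g z))" for z
  define Z0 where "Z0 = submetric Z (X' \<union> Y')"
  have Z0: "mspace Z0 = X' \<union> Y'" "mdist Z0 = mdist Z"
    using sub by (auto simp: Z0_def)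
  have inj: "inj_on h (mspace Z0)"
    using f(3) g(3) by (auto simp: Z0 h_def inj_on_def)
  obtain W :: "('a + 'b) metric" where W: "mspace W = h ` mspace Z0"
    "\<And>x y. x \<in> mspace Z0 \<Longrightarrow> y \<in> mspace Z0 \<Longrightarrow> mdist W (h x) (h y) = mdist Z0 x y"
    using transport_metric[OF inj] by blast
  have isoW: "isometric (submetric Z A) (submetric W (h ` A))" if "A \<subseteq> X' \<union> Y'" for A
    unfolding isometric_def
    by (rule exI[of _ h]) (use that sub W Z0 in \<open>auto simp: subset_iff\<close>)
  show ?thesis
  proof (rule that[of "h ` X'" W "h ` Y'"])
    show "h ` X' \<subseteq> mspace W" "h ` Y' \<subseteq> mspace W"
      using W Z0 by auto
    show "isometric (submetric W (h ` X')) X"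
      using isoW[of X'] iso(1) isometric_sym isometric_trans by blast
    show "isometric (submetric W (h ` Y')) Y"
      using isoW[of Y'] iso(2) isometric_sym isometric_trans by blast
    show "hausdorff_dist W (h ` X') (h ` Y') = hausdorff_dist Z X' Y'"
      by (rule hausdorff_dist_transport[where C = "X' \<union> Y'"]) (use W Z0 sub in auto)
  qed
qed

lemma gh_distance_isometric:
  fixes X X' :: "'a metric" and Y Y' :: "'b metric"
  assumes "isometric X X'" "isometric Y Y'"
  shows "gh_distance X Y = gh_distance X' Y'"
proof -
  have "isometric A X \<longleftrightarrow> isometric A X'" for A :: "('a + 'b) metric"
    using isometric_trans[of A X X'] isometric_trans[of A X' X] assms(1) isometric_sym[OF assms(1)]
    by blast
  moreover have "isometric A Y \<longleftrightarrow> isometric A Y'" for A :: "('a + 'b) metric"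
    using isometric_trans[of A Y Y'] isometric_trans[of A Y' Y] assms(2) isometric_sym[OF assms(2)]
    by blast
  ultimately show ?thesis
    unfolding gh_distance_def by simp
qed

lemma equiv_isometry_rel: "equiv compact_metrics isometry_rel"
proof (rule equivI)
  show "isometry_rel \<subseteq> compact_metrics \<times> compact_metrics"
    by (auto simp: isometry_rel_def)
  show "refl_on compact_metrics isometry_rel"
    by (auto simp: refl_on_def isometry_rel_def isometric_refl)
  show "sym isometry_rel"
    by (auto simp: sym_def isometry_rel_def isometric_sym)
  show "trans isometry_rel"
    unfolding trans_def isometry_rel_def using isometric_trans by blast
qed

lemma gh_dist_class:
  assumes "X \<in> compact_metrics" "Y \<in> compact_metrics"
  shows "gh_dist (isometry_rel `` {X}) (isometry_rel `` {Y}) = gh_distance X Y"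
  unfolding gh_dist_def
proof (rule the_equality)
  show "\<exists>X'\<in>isometry_rel `` {X}. \<exists>Y'\<in>isometry_rel `` {Y}. gh_distance X Y = gh_distance X' Y'"
    using assms by (auto simp: isometry_rel_def intro: isometric_refl)
  show "r = gh_distance X Y"
    if r: "\<exists>X'\<in>isometry_rel `` {X}. \<exists>Y'\<in>isometry_rel `` {Y}. r = gh_distance X' Y'" for r
  proof -
    obtain X' Y' :: "real metric" where "isometric X X'" "isometric Y Y'" "r = gh_distance X' Y'"
      using r by (auto simp: isometry_rel_def)
    then show ?thesis
      using gh_distance_isometric by metis
  qed
qed

lemma gh_dist_commute: "gh_dist c c' = gh_dist c' c"
proof -
  have *: "hausdorff_dist Z A B = hausdorff_dist Z B A" for Z :: "(real + real) metric" and A B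
    unfolding hausdorff_dist_def
    by (rule arg_cong[where f = Inf], rule Collect_cong, rule conj_cong[OF refl], rule conj_commute)
  have sym: "gh_distance X Y = gh_distance Y X" for X Y :: "real metric"
    unfolding gh_distance_def
  proof (rule arg_cong[where f = Inf], rule Collect_cong)
    fix r
    show "(\<exists>(Z :: (real + real) metric) X' Y'. X' \<subseteq> mspace Z \<and> Y' \<subseteq> mspace Z \<and>
        isometric (submetric Z X') X \<and> isometric (submetric Z Y') Y \<and> hausdorff_dist Z X' Y' \<le> r) \<longleftrightarrow>
      (\<exists>(Z :: (real + real) metric) X' Y'. X' \<subseteq> mspace Z \<and> Y' \<subseteq> mspace Z \<and>
        isometric (submetric Z X') Y \<and> isometric (submetric Z Y') X \<and> hausdorff_dist Z X' Y' \<le> r)"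
      (is "?L \<longleftrightarrow> ?R")
    proof
      assume ?L
      then obtain Z :: "(real + real) metric" and X' Y' where
        "X' \<subseteq> mspace Z" "Y' \<subseteq> mspace Z" "isometric (submetric Z X') X"
        "isometric (submetric Z Y') Y" "hausdorff_dist Z X' Y' \<le> r" by blast
      then show ?R
        by (intro exI[of _ Z] exI[of _ Y'] exI[of _ X']) (simp add: *[of Z Y' X'])
    next
      assume ?R
      then obtain Z :: "(real + real) metric" and X' Y' where
        "X' \<subseteq> mspace Z" "Y' \<subseteq> mspace Z" "isometric (submetric Z X') Y"
        "isometric (submetric Z Y') X" "hausdorff_dist Z X' Y' \<le> r" by blast
      then show ?L
        by (intro exI[of _ Z] exI[of _ Y'] exI[of _ X']) (simp add: *[of Z Y' X'])
    qed
  qed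
  have "(\<exists>X\<in>c. \<exists>Y\<in>c'. r = gh_distance X Y) \<longleftrightarrow> (\<exists>X\<in>c'. \<exists>Y\<in>c. r = gh_distance X Y)" for r
    by (intro iffI; elim bexE; intro bexI) (simp_all add: sym)
  then show ?thesis
    unfolding gh_dist_def by simp
qed

lemma edge_length_pair:
  assumes "\<And>x y. d x y = d y x"
  shows "edge_length d {v, w} = d v w"
  unfolding edge_length_def
proof (rule the_equality)
  show "r = d v w" if "\<exists>v' w'. {v, w} = {v', w'} \<and> r = d v' w'" for r
    using that assms[of v w] by (auto simp only: doubleton_eq_iff)
qed blast

lemma compact_metric_isometric_real:
  fixes X :: "'a metric"
  assumes "compact_space (mtopology_of X)"
  obtains Y :: "real metric" where "isometric X Y"
proof -
  interpret Metric_space "mspace X" "mdist X" by (rule Metric_space_mspace_mdist)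
  have "mtotally_bounded (mspace X)"
    using assms by (simp add: mtopology_of_def compact_space_eq_mcomplete_mtotally_bounded)
  then have "\<exists>K. finite K \<and> K \<subseteq> mspace X \<and> mspace X \<subseteq> (\<Union>x\<in>K. mball x (1 / real (Suc n)))" for n
    by (simp add: mtotally_bounded_def)
  then obtain K where K: "\<And>n. finite (K n)" "\<And>n. K n \<subseteq> mspace X"
    "\<And>n. mspace X \<subseteq> (\<Union>x\<in>K n. mball x (1 / real (Suc n)))"
    by metis
  define D where "D = (\<Union>n. K n)"
  have D: "countable D" "D \<subseteq> mspace X"
    using K by (auto simp: D_def intro: countable_finite)
  define \<phi> where "\<phi> x = (\<lambda>(k, n). prod_encode (to_nat_on D k, n)) `
      {(k, n). k \<in> D \<and> mdist X k x < 1 / real (Suc n)}" for x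
  have mem: "prod_encode (to_nat_on D k, n) \<in> \<phi> x \<longleftrightarrow> mdist X k x < 1 / real (Suc n)"
    if "k \<in> D" for k n x
    using that D(1) by (auto simp: \<phi>_def)
  have "inj_on \<phi> (mspace X)"
  proof (rule inj_onI, rule ccontr)
    fix x y assume xy: "x \<in> mspace X" "y \<in> mspace X" "\<phi> x = \<phi> y" "x \<noteq> y"
    then have "mdist X x y / 2 > 0"
      by simp
    then obtain n where n: "1 / real (Suc n) < mdist X x y / 2"
      by (rule nat_approx_posE)
    obtain k where k: "k \<in> K n" "mdist X k x < 1 / real (Suc n)"
      using K(3)[of n] xy(1) by auto
    then have "k \<in> D"
      by (auto simp: D_def)
    then have "mdist X k y < 1 / real (Suc n)"
      using mem k(2) xy(3) by metis
    moreover have "mdist X x y \<le> mdist X k x + mdist X k y"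
      using triangle'' xy(1,2) \<open>k \<in> D\<close> D(2) by blast
    ultimately show False
      using n k(2) by linarith
  qed
  moreover obtain \<psi> :: "nat set \<Rightarrow> real" where "inj \<psi>"
    using nat_sets_eqpoll_reals by (metis bij_betw_def eqpoll_def)
  ultimately have "inj_on (\<psi> \<circ> \<phi>) (mspace X)"
    by (metis comp_inj_on inj_on_subset subset_UNIV)
  then obtain Y :: "real metric" where "mspace Y = (\<psi> \<circ> \<phi>) ` mspace X"
    "\<And>x y. x \<in> mspace X \<Longrightarrow> y \<in> mspace X \<Longrightarrow> mdist Y ((\<psi> \<circ> \<phi>) x) ((\<psi> \<circ> \<phi>) y) = mdist X x y"
    using transport_metric by blast
  then have "isometric X Y"
    unfolding isometric_def by metis
  then show ?thesis
    by (rule that)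
qed

end

theory Submission
  imports Defs
begin

text \<open>Given a tree on the Gromov--Hausdorff space connecting \<open>M\<close>, choose along each edge an almost
  optimal correspondence. Because the graph is a tree, each point of each space in \<open>M\<close> extends to
  a section, a choice of one point in every vertex space compatible with the correspondences.
  These finitely many sections form an index set \<open>I\<close>, and each vertex space induces a pseudometric
  on \<open>I\<close>; the edge lengths do not grow if Gromov--Hausdorff distances are replaced by half the
  supremum distance of the pseudometrics. At a vertex in \<open>M\<close> this is the pullback of the metric
  along a surjection from \<open>I\<close>, so only finitely many positions of the terminals occur. Conversely,
  passing to metric quotients does not increase distances. This reduces the problem to finitely
  many Steiner problems in the space of pseudometrics on a finite set, where closed balls are
  compact and the minimum is attained.\<close>

section \<open>Steiner trees in proper spaces\<close>

text \<open>The index set removes this obstacle. It has one index for each point of each space in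
  \<open>M\<close>, so it depends on \<open>M\<close> alone, and every competitor is compared with a
  tree of pseudometrics on this one finite set. A second obstacle is the unbounded number of inner
  vertices; it is met by a recursion over sets of leaves. The factor 1/2 comes from the description
  of the Gromov--Hausdorff distance as half the infimum of the distortions of correspondences.
  Almost optimal correspondences are enough because the lower bound on lengths is proved up to an
  arbitrary \<open>e > 0\<close>. Pseudometrics replace metrics because different sections may agree
  at a vertex, and because limits of metrics may degenerate.\<close>

locale proper_space =
  fixes S :: "'a::topological_space set" and d :: "'a \<Rightarrow> 'a \<Rightarrow> real"
  assumes nonneg: "x \<in> S \<Longrightarrow> y \<in> S \<Longrightarrow> 0 \<le> d x y"
    and refl: "x \<in> S \<Longrightarrow> d x x = 0"
    and commute: "d x y = d y x"
    and triangle: "x \<in> S \<Longrightarrow> y \<in> S \<Longrightarrow> z \<in> S \<Longrightarrow> d x z \<le> d x y + d y z"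
    and continuous: "x \<in> S \<Longrightarrow> continuous_on S (d x)"
    and compact_cball: "x \<in> S \<Longrightarrow> compact {y \<in> S. d x y \<le> C}"
begin

text \<open>The topology is the one of the type and is linked to \<open>d\<close> by the continuity
  of each \<open>d x\<close>. As y tends to x this gives that \<open>d x y\<close> tends to
  \<open>d x x\<close>, which is 0, and \<open>d x y\<close> bounds the change of
  \<open>f\<close>.\<close>

lemma lipschitz_imp_continuous_on:
  fixes f :: "'a \<Rightarrow> real"
  assumes "\<And>x y. x \<in> S \<Longrightarrow> y \<in> S \<Longrightarrow> f x \<le> f y + d x y"
  shows "continuous_on S f"
  unfolding continuous_on_def
proof
  fix x assume x: "x \<in> S"
  have "(d x \<longlongrightarrow> 0) (at x within S)"
    using continuous[OF x] x refl unfolding continuous_on_def by metis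
  moreover have "\<forall>\<^sub>F y in at x within S. norm (f y - f x) \<le> d x y"
    unfolding eventually_at_filter
  proof (rule always_eventually, safe)
    fix y assume "y \<in> S"
    then show "norm (f y - f x) \<le> d x y"
      using assms[of x y] assms[of y x] x commute[of x y] by (simp add: abs_le_iff)
  qed
  ultimately have "((\<lambda>y. f y - f x) \<longlongrightarrow> 0) (at x within S)"
    by (rule Lim_null_comparison[rotated])
  then show "(f \<longlongrightarrow> f x) (at x within S)"
    by (rule LIM_zero_cancel)
qed

text \<open>Dreyfus--Wagner recursion: \<open>steiner_cost p B x c\<close> says that \<open>c\<close> is the length of
  some tree with root \<open>x\<close> and leaves \<open>p b\<close>, \<open>b \<in> B\<close>, in which every inner node splits
  the set of leaves. For finite \<open>B\<close> this allows only boundedly many nodes, which is what makes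
  the minimum attainable.\<close>

inductive steiner_cost :: "('b \<Rightarrow> 'a) \<Rightarrow> 'b set \<Rightarrow> 'a \<Rightarrow> real \<Rightarrow> bool" for p where
  empty: "x \<in> S \<Longrightarrow> steiner_cost p {} x 0"
| single: "x \<in> S \<Longrightarrow> p b \<in> S \<Longrightarrow> steiner_cost p {b} x (d x (p b))"
| join: "x \<in> S \<Longrightarrow> steiner_cost p A y c \<Longrightarrow> steiner_cost p B y c' \<Longrightarrow> A \<inter> B = {} \<Longrightarrow>
    A \<noteq> {} \<Longrightarrow> B \<noteq> {} \<Longrightarrow> steiner_cost p (A \<union> B) x (d x y + c + c')"

lemma steiner_cost_carrier: "steiner_cost p B x c \<Longrightarrow> x \<in> S"
  by (induction rule: steiner_cost.induct) auto

lemma steiner_cost_nonneg: "steiner_cost p B x c \<Longrightarrow> 0 \<le> c"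
proof (induction rule: steiner_cost.induct)
  case (join x A y c B c')
  then show ?case
    using nonneg[of x y] steiner_cost_carrier by fastforce
qed (auto simp: nonneg)

text \<open>Only the edge at the root changes, so the triangle inequality for this one edge is
  enough. Consequently the minimal cost is 1-Lipschitz in the root.\<close>

lemma steiner_cost_move:
  assumes "steiner_cost p B y c" "x \<in> S"
  obtains c' where "steiner_cost p B x c'" "c' \<le> c + d x y"
  using assms(1)
proof cases
  case empty
  then show ?thesis
    using that[of 0] assms nonneg steiner_cost.empty by auto
next
  case (single b)
  then show ?thesis
    using that[of "d x (p b)"] assms(2) triangle[of x y "p b"] steiner_cost.single[of x p b]
    by (auto simp: add.commute)
next
  case (join A z c1 B' c2)
  have "z \<in> S"
    using steiner_cost_carrier join by blast
  then have "d x z + c1 + c2 \<le> c + d x y"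
    using triangle[OF assms(2) \<open>y \<in> S\<close>, of z] join(2) by simp
  moreover have "steiner_cost p B x (d x z + c1 + c2)"
    unfolding join(1) by (rule steiner_cost.join) (use assms(2) join in simp_all)
  ultimately show ?thesis
    using that by blast
qed

text \<open>The branching point is placed at the root itself, where its edge has length
  \<open>d x x = 0\<close>. The rule \<open>join\<close> excludes empty parts; in that case the
  other tree already serves.\<close>

lemma steiner_cost_union:
  assumes "steiner_cost p A x c" "steiner_cost p B x c'" "A \<inter> B = {}"
  obtains c'' where "steiner_cost p (A \<union> B) x c''" "c'' \<le> c + c'"
proof -
  have x: "x \<in> S" "0 \<le> c" "0 \<le> c'"
    using assms steiner_cost_carrier steiner_cost_nonneg by blast+
  consider "A = {}" | "B = {}" | "A \<noteq> {}" "B \<noteq> {}" by blast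
  then show ?thesis
  proof cases
    case 3
    then show ?thesis
      using that[of "d x x + c + c'"] steiner_cost.join[OF x(1) assms(1,2)] assms(3) refl[OF x(1)]
      by auto
  qed (use that assms x in auto)
qed

text \<open>With at least two leaves, a tree is determined by its first branching point
  \<open>y\<close>, the split of \<open>B\<close> into two smaller nonempty sets, and a tree over
  each of them with root \<open>y\<close>. By induction both can be taken minimal; what remains is a
  continuous function of \<open>y\<close> for each of finitely many splits.\<close>

lemma steiner_cost_minimum:
  assumes "finite B" "p ` B \<subseteq> S" "x \<in> S"
  shows "\<exists>c. steiner_cost p B x c \<and> (\<forall>c'. steiner_cost p B x c' \<longrightarrow> c \<le> c')"
  using assms
proof (induction B arbitrary: x rule: finite_psubset_induct)
  case (psubset B)
  consider "B = {}" | b where "B = {b}" | "B \<noteq> {}" "\<nexists>b. B = {b}" by blast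
  then show ?case
  proof cases
    case 1
    then show ?thesis
      using steiner_cost.empty[of x p] psubset.prems steiner_cost_nonneg by blast
  next
    case (2 b)
    have "d x (p b) = c'" if "steiner_cost p {b} x c'" for c'
      using that
    proof cases
      case (join A y c1 A' c2)
      then have "A = {b}" "A' = {b}"
        using Un_singleton_iff[of A A' b] by auto
      then show ?thesis
        using join(6) by simp
    next
      case (single a)
      then have "a = b"
        by blast
      then show ?thesis
        using single by simp
    qed simp
    then show ?thesis
      using 2 steiner_cost.single[of x p b] psubset.prems by auto
  next
    case 3
    define Q where "Q = {A. A \<subset> B \<and> A \<noteq> {}}"
    have Q: "finite Q" "Q \<noteq> {}"
    proof -
      show "finite Q"
        using psubset.hyps by (auto simp: Q_def intro: finite_subset[of _ "Pow B"])
      obtain b where "b \<in> B" using 3 by blast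
      then have "{b} \<in> Q" using 3 by (auto simp: Q_def)
      then show "Q \<noteq> {}" by blast
    qed
    have compl: "B - A \<in> Q" if "A \<in> Q" for A
      using that by (auto simp: Q_def)
    have "\<forall>A\<in>Q. \<forall>y\<in>S. \<exists>c. steiner_cost p A y c \<and> (\<forall>c'. steiner_cost p A y c' \<longrightarrow> c \<le> c')"
    proof (intro ballI)
      fix A y assume "A \<in> Q" "y \<in> S"
      then show "\<exists>c. steiner_cost p A y c \<and> (\<forall>c'. steiner_cost p A y c' \<longrightarrow> c \<le> c')"
        using psubset.IH[of A y] psubset.prems(1) by (auto simp: Q_def)
    qed
    then obtain m where m: "\<And>A y. A \<in> Q \<Longrightarrow> y \<in> S \<Longrightarrow> steiner_cost p A y (m A y)"
      "\<And>A y c. A \<in> Q \<Longrightarrow> y \<in> S \<Longrightarrow> steiner_cost p A y c \<Longrightarrow> m A y \<le> c"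
      by metis
    have cont_m: "continuous_on S (m A)" if A: "A \<in> Q" for A
    proof (rule lipschitz_imp_continuous_on)
      fix x y assume xy: "x \<in> S" "y \<in> S"
      obtain c where "steiner_cost p A x c" "c \<le> m A y + d x y"
        using steiner_cost_move[OF m(1)[OF A xy(2)] xy(1)] .
      then show "m A x \<le> m A y + d x y"
        using m(2)[OF A xy(1)] by fastforce
    qed
    define g where "g A y = d x y + m A y + m (B - A) y" for A y
    have "\<exists>y\<in>S. \<forall>z\<in>S. g A y \<le> g A z" if A: "A \<in> Q" for A
    proof -
      \<comment> \<open>Outside this compact ball \<open>g A y\<close>, being at least
        \<open>d x y\<close>, exceeds the value at \<open>x\<close>, so a minimum on the ball is a
        minimum on \<open>S\<close>.\<close>
      let ?K = "{y \<in> S. d x y \<le> g A x}"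
      have cont: "continuous_on S (g A)"
        unfolding g_def using continuous[OF psubset.prems(2)] cont_m A compl
        by (intro continuous_intros) auto
      have g: "d x y \<le> g A y" if "y \<in> S" for y
        using steiner_cost_nonneg[OF m(1)[OF A that]] steiner_cost_nonneg[OF m(1)[OF compl[OF A] that]]
        by (simp add: g_def)
      have "x \<in> ?K"
        using psubset.prems g by auto
      moreover have "continuous_on ?K (g A)"
        using cont by (rule continuous_on_subset) auto
      ultimately obtain y where y: "y \<in> ?K" "\<forall>z\<in>?K. g A y \<le> g A z"
        using continuous_attains_inf[OF compact_cball[OF psubset.prems(2)]] by blast
      have "g A y \<le> g A z" if z: "z \<in> S" for z
      proof (cases "z \<in> ?K")
        case False
        then have "g A x \<le> g A z"
          using g[OF z] z by auto
        moreover have "g A y \<le> g A x"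
          using y \<open>x \<in> ?K\<close> by blast
        ultimately show ?thesis by simp
      qed (use y in blast)
      then show ?thesis
        using y(1) by blast
    qed
    then obtain Y where Y: "\<And>A. A \<in> Q \<Longrightarrow> Y A \<in> S" "\<And>A z. A \<in> Q \<Longrightarrow> z \<in> S \<Longrightarrow> g A (Y A) \<le> g A z"
      by metis
    define A0 where "A0 = arg_min_on (\<lambda>A. g A (Y A)) Q"
    have A0: "A0 \<in> Q" "\<And>A. A \<in> Q \<Longrightarrow> g A0 (Y A0) \<le> g A (Y A)"
      using arg_min_if_finite[OF Q] arg_min_least[OF Q] by (auto simp: A0_def)
    have "steiner_cost p (A0 \<union> (B - A0)) x (g A0 (Y A0))"
      unfolding g_def
    proof (rule steiner_cost.join)
      show "steiner_cost p A0 (Y A0) (m A0 (Y A0))"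
        "steiner_cost p (B - A0) (Y A0) (m (B - A0) (Y A0))"
        using m(1) A0(1) compl Y(1) by blast+
      show "A0 \<noteq> {}" "B - A0 \<noteq> {}"
        using A0(1) by (auto simp: Q_def)
    qed (use psubset.prems in auto)
    moreover have "A0 \<union> (B - A0) = B"
      using A0(1) by (auto simp: Q_def)
    moreover have "g A0 (Y A0) \<le> c'" if "steiner_cost p B x c'" for c'
      using that
    proof cases
      case empty
      then show ?thesis using 3 by simp
    next
      case (single b)
      then show ?thesis using 3 by blast
    next
      case (join A y c1 B' c2)
      have A: "A \<in> Q" and B': "B - A = B'"
        using join(1,6-8) by (auto simp: Q_def)
      have y: "y \<in> S"
        using join steiner_cost_carrier by blast
      have "g A0 (Y A0) \<le> g A y"
        using A0(2)[OF A] Y(2)[OF A y] by linarith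
      also have "\<dots> \<le> c'"
        using m(2)[OF A y join(4)] m(2)[OF compl[OF A] y, unfolded B', OF join(5)] join(2) B'
        by (simp add: g_def)
      finally show ?thesis .
    qed
    ultimately show ?thesis
      by (intro exI[of _ "g A0 (Y A0)"]) simp
  qed
qed

end

section \<open>Rooted trees and connected graphs\<close>

text \<open>Splitting a tree at one edge between two roots is the decomposition that both later
  inductions follow: the bound on Steiner costs and the gluing of sections.\<close>

inductive rooted_tree :: "'v \<Rightarrow> 'v set \<Rightarrow> 'v set set \<Rightarrow> bool" where
  vertex: "rooted_tree r {r} {}"
| join: "rooted_tree r V E \<Longrightarrow> rooted_tree v V' E' \<Longrightarrow> V \<inter> V' = {} \<Longrightarrow>
    rooted_tree r (V \<union> V') (insert {r, v} (E \<union> E'))"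

lemma rooted_tree_graph:
  "rooted_tree r V E \<Longrightarrow> finite V \<and> r \<in> V \<and> finite E \<and> (\<forall>e\<in>E. e \<subseteq> V \<and> card e = 2)"
proof (induction rule: rooted_tree.induct)
  case (join r V E v V' E')
  then have "r \<noteq> v"
    by blast
  then show ?case
    using join.IH by auto
qed simp

lemma rooted_tree_edges:
  assumes "rooted_tree r V E" "rooted_tree v V' E'" "V \<inter> V' = {}"
  shows "E \<inter> E' = {}" "{r, v} \<notin> E \<union> E'"
proof -
  note g = rooted_tree_graph[OF assms(1)] rooted_tree_graph[OF assms(2)]
  show "E \<inter> E' = {}"
  proof (rule ccontr)
    assume "E \<inter> E' \<noteq> {}"
    then obtain e where "e \<in> E" "e \<in> E'" by blast
    then have "e \<subseteq> {}" "card e = 2" using g assms(3) by blast+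
    then show False by simp
  qed
  have "v \<notin> V" "r \<notin> V'"
    using g assms(3) by blast+
  then have "\<not> {r, v} \<subseteq> V" "\<not> {r, v} \<subseteq> V'"
    by simp_all
  moreover have "\<And>e. e \<in> E \<Longrightarrow> e \<subseteq> V" "\<And>e. e \<in> E' \<Longrightarrow> e \<subseteq> V'"
    using g by simp_all
  ultimately show "{r, v} \<notin> E \<union> E'"
    by (meson UnE)
qed

lemma sum_rooted_tree_join:
  fixes f :: "'v set \<Rightarrow> real"
  assumes "rooted_tree r V E" "rooted_tree v V' E'" "V \<inter> V' = {}"
  shows "sum f (insert {r, v} (E \<union> E')) = f {r, v} + sum f E + sum f E'"
proof -
  have "finite E" "finite E'"
    using rooted_tree_graph[OF assms(1)] rooted_tree_graph[OF assms(2)] by blast+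
  then show ?thesis
    using rooted_tree_edges[OF assms] by (simp add: sum.union_disjoint)
qed

text \<open>The rule \<open>join\<close> attaches at the root only. A leaf at another vertex is
  pushed down into the part that contains this vertex, so trees can grow anywhere.\<close>

lemma rooted_tree_add_leaf:
  "rooted_tree r V E \<Longrightarrow> v \<in> V \<Longrightarrow> w \<notin> V \<Longrightarrow> rooted_tree r (insert w V) (insert {v, w} E)"
proof (induction rule: rooted_tree.induct)
  case (vertex r)
  then show ?case
    using rooted_tree.join[OF rooted_tree.vertex[of r] rooted_tree.vertex[of w]]
    by (simp add: insert_commute)
next
  case (join r V E u V' E')
  show ?case
  proof (cases "v \<in> V")
    case True
    then have "rooted_tree r (insert w V) (insert {v, w} E)"
      using join by blast
    from rooted_tree.join[OF this join.hyps(2)] show ?thesis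
      using join by (simp add: insert_commute)
  next
    case False
    then have "rooted_tree u (insert w V') (insert {v, w} E')"
      using join by blast
    from rooted_tree.join[OF join.hyps(1) this] show ?thesis
      using join by (simp add: insert_commute)
  qed
qed

text \<open>A largest subtree with root \<open>r\<close> contains every vertex reachable from
  \<open>r\<close>: an edge leaving it would supply a further leaf.\<close>

lemma spanning_rooted_tree:
  assumes fin: "finite V" and conn: "connected_graph (V, E)" and r: "r \<in> V"
    and sub: "\<forall>e\<in>E. e \<subseteq> V"
  obtains E' where "E' \<subseteq> E" "rooted_tree r V E'"
proof -
  define P where "P W \<longleftrightarrow> W \<subseteq> V \<and> (\<exists>E'\<subseteq>E. rooted_tree r W E')" for W
  have "P {r}"
    unfolding P_def using r rooted_tree.vertex[of r] by (intro conjI exI[of _ "{}"]) simp_all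
  moreover have "\<forall>W. P W \<longrightarrow> card W < Suc (card V)"
    using fin card_mono by (auto simp: P_def less_Suc_eq_le)
  ultimately obtain W where W: "P W" "\<And>W'. P W' \<Longrightarrow> card W' \<le> card W"
    using ex_has_greatest_nat[of P "{r}" card "Suc (card V)"] by blast
  obtain E' where E': "E' \<subseteq> E" "rooted_tree r W E'" "W \<subseteq> V"
    using W(1) unfolding P_def by blast
  have "V \<subseteq> W"
  proof
    fix u assume "u \<in> V"
    then have "(r, u) \<in> {(x, y). {x, y} \<in> E}\<^sup>*"
      using conn r by (auto simp: connected_graph_def)
    then show "u \<in> W"
    proof induction
      case base
      show ?case using rooted_tree_graph[OF E'(2)] by blast
    next
      case (step v w)
      show ?case
      proof (rule ccontr)
        assume w: "w \<notin> W"
        have "rooted_tree r (insert w W) (insert {v, w} E')"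
          using rooted_tree_add_leaf[OF E'(2) step.IH w] .
        moreover have "insert {v, w} E' \<subseteq> E" "insert w W \<subseteq> V"
          using step E' sub by auto
        ultimately have "P (insert w W)"
          unfolding P_def by (intro conjI exI[of _ "insert {v, w} E'"])
        then show False
          using W(2)[of "insert w W"] w finite_subset[OF E'(3) fin] by simp
      qed
    qed
  qed
  then have "W = V"
    using E'(3) by blast
  then show ?thesis
    using that E'(1,2) by blast
qed

section \<open>Assembling connecting graphs\<close>

lemma graph_connects_vertex: "x \<in> S \<Longrightarrow> graph_connects S {x} ({x}, {})"
  by (auto simp: graph_connects_def graph_on_def connected_graph_def)

text \<open>Only an inequality can be claimed: if \<open>x\<close> is already a vertex, possibly
  \<open>y\<close> itself, the graph is left as it is.\<close>

lemma graph_connects_insert_edge: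
  fixes d :: "'a \<Rightarrow> 'a \<Rightarrow> real"
  assumes sym: "\<And>x y. d x y = d y x" and nn: "0 \<le> d x y"
    and G: "graph_connects S M G" and y: "y \<in> fst G" and x: "x \<in> S"
  obtains G' where "graph_connects S (insert x M) G'" "graph_length d G' \<le> d x y + graph_length d G"
proof (cases "x \<in> fst G")
  case True
  then show ?thesis
    using G nn that[of G] by (auto simp: graph_connects_def)
next
  case False
  obtain V E where VE: "G = (V, E)" by force
  define E' where "E' = insert {x, y} E"
  have finE: "finite E"
  proof -
    have "E \<subseteq> Pow V" "finite V"
      using G by (auto simp: graph_connects_def graph_on_def VE)
    then show ?thesis by (meson finite_Pow_iff finite_subset)
  qed
  let ?R = "{(x, y). {x, y} \<in> E}" and ?R' = "{(x, y). {x, y} \<in> E'}"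
  have mono: "?R\<^sup>* \<subseteq> ?R'\<^sup>*"
    by (rule rtrancl_mono) (auto simp: E'_def)
  have y': "(u, y) \<in> ?R'\<^sup>*" "(y, u) \<in> ?R'\<^sup>*" if "u \<in> V" for u
  proof -
    have "(u, y) \<in> ?R\<^sup>*" "(y, u) \<in> ?R\<^sup>*"
      using that G y by (simp_all add: graph_connects_def connected_graph_def VE)
    then show "(u, y) \<in> ?R'\<^sup>*" "(y, u) \<in> ?R'\<^sup>*"
      using subsetD[OF mono] by blast+
  qed
  have x': "(x, y) \<in> ?R'\<^sup>*" "(y, x) \<in> ?R'\<^sup>*"
    by (rule r_into_rtrancl; simp add: E'_def insert_commute)+
  have y'': "(u, y) \<in> ?R'\<^sup>*" "(y, u) \<in> ?R'\<^sup>*" if "u \<in> insert x V" for u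
    using that y' x' by blast+
  have "connected_graph (insert x V, E')"
    unfolding connected_graph_def using rtrancl_trans[OF y''] by simp
  moreover have "graph_on S (insert x V, E')"
  proof -
    have "x \<noteq> y" "y \<in> V" "finite V" "V \<subseteq> S" "\<And>e. e \<in> E \<Longrightarrow> e \<subseteq> V \<and> card e = 2"
      using G y False by (auto simp: graph_connects_def graph_on_def VE)
    then show ?thesis
      using x by (auto simp: graph_on_def E'_def)
  qed
  ultimately have "graph_connects S (insert x M) (insert x V, E')"
    using G by (auto simp: graph_connects_def VE)
  moreover have "{x, y} \<notin> E"
    using G False by (auto simp: graph_connects_def graph_on_def VE)
  then have "graph_length d (insert x V, E') = d x y + graph_length d G"
    using finE by (simp add: graph_length_def E'_def VE edge_length_pair[OF sym])
  ultimately show ?thesis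
    using that[of "(insert x V, E')"] by (auto simp: VE)
qed

text \<open>Edges common to both graphs are counted once in the union; the inequality uses that
  their lengths are nonnegative.\<close>

lemma graph_connects_union:
  fixes d :: "'a \<Rightarrow> 'a \<Rightarrow> real"
  assumes sym: "\<And>x y. d x y = d y x" and nn: "\<And>x y. x \<in> S \<Longrightarrow> y \<in> S \<Longrightarrow> 0 \<le> d x y"
    and G: "graph_connects S M G" and G': "graph_connects S M' G'"
    and y: "y \<in> fst G" "y \<in> fst G'"
  obtains H where "graph_connects S (M \<union> M') H"
    "graph_length d H \<le> graph_length d G + graph_length d G'"
proof -
  obtain V E V' E' where VE: "G = (V, E)" "G' = (V', E')" by (metis surj_pair)
  let ?R = "{(x, y). {x, y} \<in> E}" and ?R' = "{(x, y). {x, y} \<in> E'}"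
    and ?Q = "{(x, y). {x, y} \<in> E \<union> E'}"
  have mono: "?R\<^sup>* \<subseteq> ?Q\<^sup>*" "?R'\<^sup>* \<subseteq> ?Q\<^sup>*"
    by (rule rtrancl_mono; auto)+
  have y': "(u, y) \<in> ?Q\<^sup>*" "(y, u) \<in> ?Q\<^sup>*" if "u \<in> V \<union> V'" for u
  proof -
    have "(u, y) \<in> ?R\<^sup>* \<and> (y, u) \<in> ?R\<^sup>* \<or> (u, y) \<in> ?R'\<^sup>* \<and> (y, u) \<in> ?R'\<^sup>*"
      using that G G' y unfolding graph_connects_def connected_graph_def VE by (elim UnE) simp_all
    then show "(u, y) \<in> ?Q\<^sup>*" "(y, u) \<in> ?Q\<^sup>*"
      using subsetD[OF mono(1)] subsetD[OF mono(2)] by blast+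
  qed
  then have "connected_graph (V \<union> V', E \<union> E')"
    unfolding connected_graph_def using rtrancl_trans[OF y'] by simp
  moreover have "graph_on S (V \<union> V', E \<union> E')"
    using G G' by (auto simp: graph_connects_def graph_on_def VE)
  ultimately have conn: "graph_connects S (M \<union> M') (V \<union> V', E \<union> E')"
    using G G' by (auto simp: graph_connects_def VE)
  have fin: "finite E" "finite E'"
  proof -
    have "E \<subseteq> Pow V" "finite V" "E' \<subseteq> Pow V'" "finite V'"
      using G G' by (auto simp: graph_connects_def graph_on_def VE)
    then show "finite E" "finite E'" by (meson finite_Pow_iff finite_subset)+
  qed
  have "0 \<le> edge_length d e" if e: "e \<in> E'" for e
  proof -
    have "card e = 2" "e \<subseteq> S"
      using G' e by (auto simp: graph_connects_def graph_on_def VE)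
    then obtain v w where "e = {v, w}" "v \<in> S" "w \<in> S"
      unfolding card_2_iff by blast
    then show ?thesis
      using nn by (simp add: edge_length_pair[OF sym])
  qed
  then have "0 \<le> sum (edge_length d) (E \<inter> E')"
    by (auto intro: sum_nonneg)
  then have "graph_length d (V \<union> V', E \<union> E') \<le> graph_length d G + graph_length d G'"
    using sum.union_inter[OF fin, of "edge_length d"] by (simp add: graph_length_def VE)
  then show ?thesis
    using that conn by blast
qed

section \<open>Steiner costs compared with trees and graphs\<close>

context proper_space
begin

text \<open>At a joining edge the cost of the second tree is moved from \<open>\<phi> v\<close> to
  \<open>\<phi> r\<close> at the price of the edge length, and the two costs are merged there.
  Branches without terminals shrink to the empty cost, and a terminal at an inner vertex becomes a
  leaf at distance 0. Lengths are measured through \<open>\<phi>\<close> on the original edges,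
  since \<open>\<phi>\<close> may identify vertices.\<close>

lemma steiner_cost_le_tree:
  assumes "rooted_tree r V E" "\<phi> ` V \<subseteq> S" "\<And>b. b \<in> M \<inter> V \<Longrightarrow> p b = \<phi> b"
  shows "\<exists>c. steiner_cost p (M \<inter> V) (\<phi> r) c \<and> c \<le> (\<Sum>e\<in>E. edge_length (\<lambda>u v. d (\<phi> u) (\<phi> v)) e)"
  using assms
proof (induction rule: rooted_tree.induct)
  case (vertex r)
  show ?case
  proof (cases "r \<in> M")
    case True
    then have "p r = \<phi> r" "\<phi> r \<in> S"
      using vertex by auto
    then show ?thesis
      using steiner_cost.single[of "\<phi> r" p r] refl[of "\<phi> r"] True by (intro exI[of _ 0]) simp
  next
    case False
    then show ?thesis
      using vertex steiner_cost.empty by (intro exI[of _ 0]) auto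
  qed
next
  case (join r V E v V' E')
  let ?L = "edge_length (\<lambda>u v. d (\<phi> u) (\<phi> v))"
  have rv: "r \<in> V" "v \<in> V'"
    using rooted_tree_graph[OF join.hyps(1)] rooted_tree_graph[OF join.hyps(2)] by blast+
  have "\<exists>c. steiner_cost p (M \<inter> V) (\<phi> r) c \<and> c \<le> sum ?L E"
    by (rule join.IH(1)) (use join.prems in auto)
  then obtain c where c: "steiner_cost p (M \<inter> V) (\<phi> r) c" "c \<le> sum ?L E"
    by blast
  have "\<exists>c. steiner_cost p (M \<inter> V') (\<phi> v) c \<and> c \<le> sum ?L E'"
    by (rule join.IH(2)) (use join.prems in auto)
  then obtain c' where c': "steiner_cost p (M \<inter> V') (\<phi> v) c'" "c' \<le> sum ?L E'"
    by blast
  have "\<phi> r \<in> S"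
    using rv(1) join.prems(1) by blast
  then obtain c'' where c'': "steiner_cost p (M \<inter> V') (\<phi> r) c''" "c'' \<le> c' + d (\<phi> r) (\<phi> v)"
    using steiner_cost_move[OF c'(1)] commute by metis
  have "(M \<inter> V) \<inter> (M \<inter> V') = {}"
    using join.hyps(3) by blast
  then obtain k where k: "steiner_cost p ((M \<inter> V) \<union> (M \<inter> V')) (\<phi> r) k" "k \<le> c + c''"
    using steiner_cost_union[OF c(1) c''(1)] by blast
  have "?L {r, v} = d (\<phi> r) (\<phi> v)"
    using commute by (intro edge_length_pair)
  then have "k \<le> sum ?L (insert {r, v} (E \<union> E'))"
    unfolding sum_rooted_tree_join[OF join.hyps] using k c c' c'' by linarith
  then show ?case
    using k(1) by (auto simp: Int_Un_distrib)
qed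

text \<open>Keeping the root among the connected points lets the induction join the two subgraphs at
  \<open>\<Phi> y\<close>. Vertices may coincide under \<open>\<Phi>\<close>, so the result is a
  graph that may contain cycles and may be shorter than \<open>c\<close>.\<close>

lemma steiner_cost_graph:
  fixes d' :: "'c \<Rightarrow> 'c \<Rightarrow> real"
  assumes "steiner_cost p B x c"
    and \<Phi>: "\<And>x. x \<in> S \<Longrightarrow> \<Phi> x \<in> T" "\<And>x y. x \<in> S \<Longrightarrow> y \<in> S \<Longrightarrow> d' (\<Phi> x) (\<Phi> y) \<le> d x y"
    and sym: "\<And>x y. d' x y = d' y x" and nn: "\<And>x y. x \<in> T \<Longrightarrow> y \<in> T \<Longrightarrow> 0 \<le> d' x y"
  shows "\<exists>G. graph_connects T (insert (\<Phi> x) (\<Phi> ` p ` B)) G \<and> graph_length d' G \<le> c"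
  using assms(1)
proof (induction rule: steiner_cost.induct)
  case (empty x)
  then show ?case
    using graph_connects_vertex[OF \<Phi>(1), of x]
    by (intro exI[of _ "({\<Phi> x}, {})"]) (simp add: graph_length_def)
next
  case (single x b)
  have T: "\<Phi> x \<in> T" "\<Phi> (p b) \<in> T"
    using \<Phi>(1) single by blast+
  have y: "\<Phi> (p b) \<in> fst ({\<Phi> (p b)}, {})"
    by simp
  obtain G where G: "graph_connects T {\<Phi> x, \<Phi> (p b)} G"
      "graph_length d' G \<le> d' (\<Phi> x) (\<Phi> (p b)) + graph_length d' ({\<Phi> (p b)}, {})"
    using graph_connects_insert_edge[OF sym nn[OF T] graph_connects_vertex[OF T(2)] y T(1)] .
  have "graph_length d' G \<le> d x (p b)"
    using G(2) \<Phi>(2)[OF single] by (simp add: graph_length_def)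
  then show ?case
    using G(1) by (intro exI[of _ G]) simp
next
  case (join x A y c B c')
  have y: "y \<in> S"
    using join.hyps(2) by (rule steiner_cost_carrier)
  have T: "\<Phi> x \<in> T" "\<Phi> y \<in> T"
    using \<Phi>(1) join.hyps(1) y by blast+
  obtain G1 where G1: "graph_connects T (insert (\<Phi> y) (\<Phi> ` p ` A)) G1" "graph_length d' G1 \<le> c"
    using join.IH(1) by blast
  obtain G2 where G2: "graph_connects T (insert (\<Phi> y) (\<Phi> ` p ` B)) G2" "graph_length d' G2 \<le> c'"
    using join.IH(2) by blast
  have y1: "\<Phi> y \<in> fst G1" "\<Phi> y \<in> fst G2"
    using G1 G2 by (simp_all add: graph_connects_def)
  obtain H where H: "graph_connects T (insert (\<Phi> y) (\<Phi> ` p ` A) \<union> insert (\<Phi> y) (\<Phi> ` p ` B)) H"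
    "graph_length d' H \<le> graph_length d' G1 + graph_length d' G2"
    using graph_connects_union[OF sym nn G1(1) G2(1) y1] .
  have y2: "\<Phi> y \<in> fst H"
    using H(1) by (simp add: graph_connects_def)
  obtain G where G: "graph_connects T
      (insert (\<Phi> x) (insert (\<Phi> y) (\<Phi> ` p ` A) \<union> insert (\<Phi> y) (\<Phi> ` p ` B))) G"
    "graph_length d' G \<le> d' (\<Phi> x) (\<Phi> y) + graph_length d' H"
    using graph_connects_insert_edge[OF sym nn[OF T] H(1) y2 T(1)] .
  have "graph_length d' G \<le> d x y + c + c'"
    using G(2) H(2) G1(2) G2(2) \<Phi>(2)[OF join(1) y] by linarith
  moreover have "graph_connects T (insert (\<Phi> x) (\<Phi> ` p ` (A \<union> B))) G"
    using G(1) by (simp add: graph_connects_def image_Un)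
  ultimately show ?case
    by blast
qed

end

section \<open>Correspondences and the Gromov--Hausdorff distance\<close>

text \<open>This keeps the sets under the infima in \<open>hausdorff_dist\<close> and
  \<open>gh_distance\<close> nonempty. Being invariant under isometry, it also holds for the copies
  inside an ambient space.\<close>

definition bounded_metric :: "'a metric \<Rightarrow> bool" where
  "bounded_metric X \<longleftrightarrow> mspace X \<noteq> {} \<and> (\<exists>C. \<forall>x\<in>mspace X. \<forall>y\<in>mspace X. mdist X x y \<le> C)"

lemma bounded_metric_isometric:
  assumes "isometric X Y" "bounded_metric X"
  shows "bounded_metric Y"
proof -
  obtain f where f: "f ` mspace X = mspace Y"
    "\<forall>x\<in>mspace X. \<forall>y\<in>mspace X. mdist Y (f x) (f y) = mdist X x y"
    using assms(1) unfolding isometric_def by blast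
  obtain C where "\<forall>x\<in>mspace X. \<forall>y\<in>mspace X. mdist X x y \<le> C" "mspace X \<noteq> {}"
    using assms(2) unfolding bounded_metric_def by blast
  then have "mspace Y \<noteq> {}" "\<forall>x\<in>mspace Y. \<forall>y\<in>mspace Y. mdist Y x y \<le> C"
    using f unfolding f(1)[symmetric] by auto
  then show ?thesis
    unfolding bounded_metric_def by blast
qed

lemma compact_metrics_bounded:
  assumes "X \<in> compact_metrics"
  shows "bounded_metric X"
proof -
  interpret Metric_space "mspace X" "mdist X" by (rule Metric_space_mspace_mdist)
  have "compactin mtopology (mspace X)"
    using assms by (simp add: compact_metrics_def mtopology_of_def compact_space_def)
  then have "mbounded (mspace X)"
    by (simp add: compactin_imp_mbounded)
  then show ?thesis
    using assms unfolding bounded_metric_def mbounded_alt compact_metrics_def by blast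
qed

lemma hausdorff_dist_nonempty:
  assumes A: "A \<subseteq> mspace Z" "bounded_metric (submetric Z A)"
    and B: "B \<subseteq> mspace Z" "bounded_metric (submetric Z B)"
  shows "\<exists>r>0. A \<subseteq> (\<Union>b\<in>B. mball_of Z b r) \<and> B \<subseteq> (\<Union>a\<in>A. mball_of Z a r)"
proof -
  obtain C where C: "A \<noteq> {}" "\<And>x y. x \<in> A \<Longrightarrow> y \<in> A \<Longrightarrow> mdist Z x y \<le> C"
    using A by (auto simp: bounded_metric_def Int_absorb2)
  obtain D where D: "B \<noteq> {}" "\<And>x y. x \<in> B \<Longrightarrow> y \<in> B \<Longrightarrow> mdist Z x y \<le> D"
    using B by (auto simp: bounded_metric_def Int_absorb2)
  obtain a0 b0 where a0: "a0 \<in> A" and b0: "b0 \<in> B"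
    using C D by blast
  \<comment> \<open>The absolute values let one radius serve both inclusions; the summand 1 makes
    the inequalities strict, since the balls are open.\<close>
  define r where "r = mdist Z a0 b0 + \<bar>C\<bar> + \<bar>D\<bar> + 1"
  have "A \<subseteq> mball_of Z b0 r"
  proof
    fix a assume a: "a \<in> A"
    have "mdist Z b0 a \<le> mdist Z b0 a0 + mdist Z a0 a"
      using a a0 b0 A(1) B(1) by (intro mdist_triangle) auto
    also have "\<dots> < r"
      using C(2)[OF a0 a] mdist_commute[of Z b0 a0] by (simp add: r_def)
    finally show "a \<in> mball_of Z b0 r"
      using a b0 A(1) B(1) by auto
  qed
  moreover have "B \<subseteq> mball_of Z a0 r"
  proof
    fix b assume b: "b \<in> B"
    have "mdist Z a0 b \<le> mdist Z a0 b0 + mdist Z b0 b"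
      using b a0 b0 A(1) B(1) by (intro mdist_triangle) auto
    also have "\<dots> < r"
      using D(2)[OF b0 b] by (simp add: r_def)
    finally show "b \<in> mball_of Z a0 r"
      using b a0 A(1) B(1) by auto
  qed
  moreover have "r > 0"
    using mdist_nonneg[of Z a0 b0] unfolding r_def by linarith
  ultimately show ?thesis
    using a0 b0 by blast
qed

lemma hausdorff_dist_nonneg:
  assumes "A \<subseteq> mspace Z" "bounded_metric (submetric Z A)"
    and "B \<subseteq> mspace Z" "bounded_metric (submetric Z B)"
  shows "0 \<le> hausdorff_dist Z A B"
  unfolding hausdorff_dist_def
  using hausdorff_dist_nonempty[OF assms] by (intro cInf_greatest) auto

lemma hausdorff_dist_lessE:
  assumes "A \<subseteq> mspace Z" "bounded_metric (submetric Z A)"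
    and "B \<subseteq> mspace Z" "bounded_metric (submetric Z B)" and "hausdorff_dist Z A B < r"
  obtains s where "s < r" "A \<subseteq> (\<Union>b\<in>B. mball_of Z b s)" "B \<subseteq> (\<Union>a\<in>A. mball_of Z a s)"
proof -
  let ?T = "{r. 0 < r \<and> A \<subseteq> (\<Union>b\<in>B. mball_of Z b r) \<and> B \<subseteq> (\<Union>a\<in>A. mball_of Z a r)}"
  have "?T \<noteq> {}"
    using hausdorff_dist_nonempty[OF assms(1-4)] by auto
  moreover have "Inf ?T < r"
    using assms(5) by (simp only: hausdorff_dist_def)
  ultimately have "\<exists>s\<in>?T. s < r"
    by (rule cInf_lessD)
  then show ?thesis
    using that by blast
qed

text \<open>The metric on the disjoint union puts \<open>x\<close> and \<open>y\<close> at distance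
  \<open>Inf {d x a + \<delta> + d b y | (a, b) \<in> R}\<close>.\<close>

lemma gh_glue:
  fixes X :: "'a metric" and Y :: "'b metric"
  assumes R: "R \<subseteq> mspace X \<times> mspace Y" "mspace X \<subseteq> Domain R" "mspace Y \<subseteq> Range R"
    and ne: "mspace X \<noteq> {}" and \<delta>: "\<delta> > 0"
    and dis: "\<And>x y x' y'. (x, y) \<in> R \<Longrightarrow> (x', y') \<in> R \<Longrightarrow> \<bar>mdist X x x' - mdist Y y y'\<bar> \<le> 2 * \<delta>"
  obtains Z :: "('a + 'b) metric" where "mspace Z = Inl ` mspace X \<union> Inr ` mspace Y"
    "isometric (submetric Z (Inl ` mspace X)) X" "isometric (submetric Z (Inr ` mspace Y)) Y"
    "hausdorff_dist Z (Inl ` mspace X) (Inr ` mspace Y) \<le> \<delta>"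
proof -
  let ?M = "Inl ` mspace X \<union> Inr ` mspace Y"
  define c where "c x y = Inf ((\<lambda>(a, b). mdist X x a + mdist Y b y + \<delta>) ` R)" for x y
  have Rne: "R \<noteq> {}" using ne R(2) by blast
  have c_le: "c x y \<le> mdist X x a + mdist Y b y + \<delta>" if "(a, b) \<in> R" for x y a b
    unfolding c_def
  proof (rule cInf_lower)
    show "bdd_below ((\<lambda>(a, b). mdist X x a + mdist Y b y + \<delta>) ` R)"
      using \<delta> by (intro bdd_belowI[of _ 0]) auto
  qed (use that in force)
  have c_ge: "l \<le> c x y" if "\<And>a b. (a, b) \<in> R \<Longrightarrow> l \<le> mdist X x a + mdist Y b y + \<delta>" for l x y
    unfolding c_def using that Rne by (intro cInf_greatest) auto
  have c_pos: "\<delta> \<le> c x y" for x y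
    by (rule c_ge) simp
  have tri1: "c x y \<le> mdist X x x' + c x' y" if x: "x \<in> mspace X" "x' \<in> mspace X" for x x' y
  proof -
    have "c x y - mdist X x x' \<le> c x' y"
    proof (rule c_ge)
      fix a b assume ab: "(a, b) \<in> R"
      then have "mdist X x a \<le> mdist X x x' + mdist X x' a"
        using x R(1) by (intro mdist_triangle) auto
      then show "c x y - mdist X x x' \<le> mdist X x' a + mdist Y b y + \<delta>"
        using c_le[OF ab, of x y] by linarith
    qed
    then show ?thesis by linarith
  qed
  have tri2: "c x y \<le> c x y' + mdist Y y' y" if y: "y \<in> mspace Y" "y' \<in> mspace Y" for x y y'
  proof -
    have "c x y - mdist Y y' y \<le> c x y'"
    proof (rule c_ge)
      fix a b assume ab: "(a, b) \<in> R"
      then have "mdist Y b y \<le> mdist Y b y' + mdist Y y' y"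
        using y R(1) by (intro mdist_triangle) auto
      then show "c x y - mdist Y y' y \<le> mdist X x a + mdist Y b y' + \<delta>"
        using c_le[OF ab, of x y] by linarith
    qed
    then show ?thesis by linarith
  qed
  \<comment> \<open>The distortion enters here: a detour through \<open>y\<close> crosses between
    the spaces twice, and the two summands \<open>\<delta>\<close> pay for the change of at most
    \<open>2 * \<delta>\<close> between \<open>mdist X a a'\<close> and
    \<open>mdist Y b b'\<close>.\<close>
  have tri3: "mdist X x x' \<le> c x y + c x' y"
    if x: "x \<in> mspace X" "x' \<in> mspace X" and y: "y \<in> mspace Y" for x x' y
  proof -
    have "mdist X x x' - c x' y \<le> c x y"
    proof (rule c_ge)
      fix a b assume ab: "(a, b) \<in> R"
      have "mdist X x x' - (mdist X x a + mdist Y b y + \<delta>) \<le> c x' y"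
      proof (rule c_ge)
        fix a' b' assume ab': "(a', b') \<in> R"
        have "mdist X x x' \<le> mdist X x a + mdist X a x'"
          using x ab R(1) by (intro mdist_triangle) auto
        moreover have "mdist X a x' \<le> mdist X a a' + mdist X a' x'"
          using x ab ab' R(1) by (intro mdist_triangle) auto
        moreover have "mdist Y b b' \<le> mdist Y b y + mdist Y y b'"
          using y ab ab' R(1) by (intro mdist_triangle) auto
        ultimately show "mdist X x x' - (mdist X x a + mdist Y b y + \<delta>) \<le> mdist X x' a' + mdist Y b' y + \<delta>"
          using dis[OF ab ab'] mdist_commute[of X a' x'] mdist_commute[of Y y b'] by linarith
      qed
      then show "mdist X x x' - c x' y \<le> mdist X x a + mdist Y b y + \<delta>" by linarith
    qed
    then show ?thesis by linarith
  qed
  have tri4: "mdist Y y y' \<le> c x y + c x y'"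
    if y: "y \<in> mspace Y" "y' \<in> mspace Y" and x: "x \<in> mspace X" for x y y'
  proof -
    have "mdist Y y y' - c x y' \<le> c x y"
    proof (rule c_ge)
      fix a b assume ab: "(a, b) \<in> R"
      have "mdist Y y y' - (mdist X x a + mdist Y b y + \<delta>) \<le> c x y'"
      proof (rule c_ge)
        fix a' b' assume ab': "(a', b') \<in> R"
        have "mdist Y y y' \<le> mdist Y y b + mdist Y b y'"
          using y ab R(1) by (intro mdist_triangle) auto
        moreover have "mdist Y b y' \<le> mdist Y b b' + mdist Y b' y'"
          using y ab ab' R(1) by (intro mdist_triangle) auto
        moreover have "mdist X a a' \<le> mdist X a x + mdist X x a'"
          using x ab ab' R(1) by (intro mdist_triangle) auto
        ultimately show "mdist Y y y' - (mdist X x a + mdist Y b y + \<delta>) \<le> mdist X x a' + mdist Y b' y' + \<delta>"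
          using dis[OF ab ab'] mdist_commute[of X a x] mdist_commute[of Y y b] by linarith
      qed
      then show "mdist Y y y' - c x y' \<le> mdist X x a + mdist Y b y + \<delta>" by linarith
    qed
    then show ?thesis by linarith
  qed
  define D where "D u v = (case u of
      Inl x \<Rightarrow> (case v of Inl x' \<Rightarrow> mdist X x x' | Inr y \<Rightarrow> c x y)
    | Inr y \<Rightarrow> (case v of Inl x \<Rightarrow> c x y | Inr y' \<Rightarrow> mdist Y y y'))" for u v
  have D: "D (Inl x) (Inl x') = mdist X x x'" "D (Inl x) (Inr y) = c x y"
    "D (Inr y) (Inl x) = c x y" "D (Inr y) (Inr y') = mdist Y y y'" for x x' y y'
    by (simp_all add: D_def)
  \<comment> \<open>Here \<open>\<delta>\<close> must be positive: the two copies are disjoint, so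
    \<open>D\<close> may not vanish between them.\<close>
  have c0: "c x y > 0" for x y
    using c_pos[of x y] \<delta> by linarith
  have m: "Metric_space ?M D"
  proof
    show "0 \<le> D u v" for u v
      using c0 by (cases u; cases v) (simp_all add: D less_imp_le)
    show "D u v = D v u" for u v
      by (cases u; cases v) (simp_all add: D mdist_commute)
    show "D u v = 0 \<longleftrightarrow> u = v" if "u \<in> ?M" "v \<in> ?M" for u v
      using that c0 by (cases u; cases v) (auto simp: D mdist_zero less_le)
    show "D u w \<le> D u v + D v w" if "u \<in> ?M" "v \<in> ?M" "w \<in> ?M" for u v w
    proof -
      have a: "c x y \<le> c x' y + mdist X x' x" if "x \<in> mspace X" "x' \<in> mspace X" for x x' y
        using tri1[OF that, of y] mdist_commute[of X x x'] by linarith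
      have b: "c x y \<le> mdist Y y y' + c x y'" if "y \<in> mspace Y" "y' \<in> mspace Y" for x y y'
        using tri2[OF that, of x] mdist_commute[of Y y y'] by linarith
      show ?thesis
        using that tri1 tri2 tri3 tri4 a b
        by (cases u; cases v; cases w) (auto simp: D intro: mdist_triangle)
    qed
  qed
  define Z where "Z = metric (?M, D)"
  have Z: "mspace Z = ?M" "mdist Z = D"
    unfolding Z_def using Metric_space.mspace_metric[OF m] Metric_space.mdist_metric[OF m] by auto
  have isoX: "isometric X (submetric Z (Inl ` mspace X))"
    unfolding isometric_def by (rule exI[of _ Inl]) (auto simp: Z D)
  have isoY: "isometric Y (submetric Z (Inr ` mspace Y))"
    unfolding isometric_def by (rule exI[of _ Inr]) (auto simp: Z D)
  \<comment> \<open>Related points have distance at most \<open>\<delta>\<close>, which places them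
    in open balls of each radius above \<open>\<delta>\<close>; the bound \<open>\<delta>\<close>
    itself follows by density.\<close>
  have "hausdorff_dist Z (Inl ` mspace X) (Inr ` mspace Y) \<le> r" if r: "\<delta> < r" for r
    unfolding hausdorff_dist_def
  proof (rule cInf_lower)
    have cR: "c x y < r" if "(x, y) \<in> R" for x y
    proof -
      have "x \<in> mspace X" "y \<in> mspace Y"
        using that R(1) by auto
      then show ?thesis
        using c_le[OF that, of x y] r mdist_zero[of x X x] mdist_zero[of y Y y] by fastforce
    qed
    have "Inl x \<in> (\<Union>b\<in>Inr ` mspace Y. mball_of Z b r)" if x: "x \<in> mspace X" for x
    proof -
      obtain y where y: "(x, y) \<in> R" using R(2) x by blast
      then have "y \<in> mspace Y" using R(1) by blast
      then show ?thesis using cR[OF y] x by (auto simp: Z D)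
    qed
    moreover have "Inr y \<in> (\<Union>b\<in>Inl ` mspace X. mball_of Z b r)" if y: "y \<in> mspace Y" for y
    proof -
      obtain x where x: "(x, y) \<in> R" using R(3) y by blast
      then have "x \<in> mspace X" using R(1) by blast
      then show ?thesis using cR[OF x] y by (auto simp: Z D)
    qed
    ultimately show "r \<in> {r. 0 < r \<and> Inl ` mspace X \<subseteq> (\<Union>b\<in>Inr ` mspace Y. mball_of Z b r) \<and>
        Inr ` mspace Y \<subseteq> (\<Union>a\<in>Inl ` mspace X. mball_of Z a r)}"
      using r \<delta> by auto
    show "bdd_below {r. 0 < r \<and> Inl ` mspace X \<subseteq> (\<Union>b\<in>Inr ` mspace Y. mball_of Z b r) \<and>
        Inr ` mspace Y \<subseteq> (\<Union>a\<in>Inl ` mspace X. mball_of Z a r)}"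
      by (intro bdd_belowI[of _ 0]) auto
  qed
  then have "hausdorff_dist Z (Inl ` mspace X) (Inr ` mspace Y) \<le> \<delta>"
    by (rule dense_ge)
  then show ?thesis
    using that Z(1) isometric_sym[OF isoX] isometric_sym[OF isoY] by blast
qed

section \<open>The Gromov--Hausdorff distance in terms of distortion\<close>

definition gh_bounds :: "'a metric \<Rightarrow> 'b metric \<Rightarrow> real set" where
  "gh_bounds X Y = {r. \<exists>(Z :: ('a + 'b) metric) X' Y'.
     X' \<subseteq> mspace Z \<and> Y' \<subseteq> mspace Z \<and>
     isometric (submetric Z X') X \<and> isometric (submetric Z Y') Y \<and>
     hausdorff_dist Z X' Y' \<le> r}"

lemma gh_distance_eq_Inf: "gh_distance X Y = Inf (gh_bounds X Y)"
  unfolding gh_distance_def gh_bounds_def ..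

lemma gh_bounds_nonneg:
  assumes "bounded_metric X" "bounded_metric Y" "r \<in> gh_bounds X Y"
  shows "0 \<le> r"
proof -
  obtain Z :: "('a + 'b) metric" and X' Y' where
    Z: "X' \<subseteq> mspace Z" "Y' \<subseteq> mspace Z" "isometric (submetric Z X') X"
      "isometric (submetric Z Y') Y" "hausdorff_dist Z X' Y' \<le> r"
    using assms(3) unfolding gh_bounds_def by blast
  have "bounded_metric (submetric Z X')" "bounded_metric (submetric Z Y')"
    using bounded_metric_isometric[OF isometric_sym] Z assms(1,2) by blast+
  then show ?thesis
    using hausdorff_dist_nonneg[OF Z(1) _ Z(2)] Z(5) by linarith
qed

lemma gh_boundsI:
  fixes X :: "'a metric" and Y :: "'b metric"
  assumes R: "R \<subseteq> mspace X \<times> mspace Y" "mspace X \<subseteq> Domain R" "mspace Y \<subseteq> Range R"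
    and ne: "mspace X \<noteq> {}" and \<delta>: "\<delta> > 0"
    and dis: "\<And>x y x' y'. (x, y) \<in> R \<Longrightarrow> (x', y') \<in> R \<Longrightarrow> \<bar>mdist X x x' - mdist Y y y'\<bar> \<le> 2 * \<delta>"
  shows "\<delta> \<in> gh_bounds X Y"
proof -
  obtain Z :: "('a + 'b) metric" where "mspace Z = Inl ` mspace X \<union> Inr ` mspace Y"
    "isometric (submetric Z (Inl ` mspace X)) X" "isometric (submetric Z (Inr ` mspace Y)) Y"
    "hausdorff_dist Z (Inl ` mspace X) (Inr ` mspace Y) \<le> \<delta>"
    using gh_glue[OF assms] .
  then show ?thesis
    unfolding gh_bounds_def
    by (intro CollectI exI[of _ Z] exI[of _ "Inl ` mspace X"] exI[of _ "Inr ` mspace Y"]) simp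
qed

lemma gh_bounds_nonempty:
  assumes "bounded_metric X" "bounded_metric Y"
  shows "gh_bounds X Y \<noteq> {}"
proof -
  obtain C where C: "mspace X \<noteq> {}" "\<And>x y. x \<in> mspace X \<Longrightarrow> y \<in> mspace X \<Longrightarrow> mdist X x y \<le> C"
    using assms(1) unfolding bounded_metric_def by blast
  obtain D where D: "mspace Y \<noteq> {}" "\<And>x y. x \<in> mspace Y \<Longrightarrow> y \<in> mspace Y \<Longrightarrow> mdist Y x y \<le> D"
    using assms(2) unfolding bounded_metric_def by blast
  \<comment> \<open>The full product is a correspondence whose distortion is bounded by the
    diameters; the 1 ensures positivity.\<close>
  have "\<bar>C\<bar> + \<bar>D\<bar> + 1 \<in> gh_bounds X Y"
  proof (rule gh_boundsI[of "mspace X \<times> mspace Y"])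
    fix x y x' y' assume "(x, y) \<in> mspace X \<times> mspace Y" "(x', y') \<in> mspace X \<times> mspace Y"
    then have "x \<in> mspace X" "x' \<in> mspace X" "y \<in> mspace Y" "y' \<in> mspace Y"
      by auto
    then show "\<bar>mdist X x x' - mdist Y y y'\<bar> \<le> 2 * (\<bar>C\<bar> + \<bar>D\<bar> + 1)"
      by (smt (verit) C(2) D(2) mdist_nonneg)
  qed (use C D in auto)
  then show ?thesis by blast
qed

lemma gh_distance_nonneg:
  assumes "bounded_metric X" "bounded_metric Y"
  shows "0 \<le> gh_distance X Y"
  unfolding gh_distance_eq_Inf
  using gh_bounds_nonempty[OF assms] gh_bounds_nonneg[OF assms] by (rule cInf_greatest)

text \<open>Gluing requires a positive parameter, so each \<open>r\<close> above
  \<open>\<delta>\<close> is used; this also covers \<open>\<delta> = 0\<close>.\<close>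

lemma gh_distance_le:
  assumes b: "bounded_metric X" "bounded_metric Y"
    and R: "R \<subseteq> mspace X \<times> mspace Y" "mspace X \<subseteq> Domain R" "mspace Y \<subseteq> Range R"
    and \<delta>: "\<delta> \<ge> 0"
    and dis: "\<And>x y x' y'. (x, y) \<in> R \<Longrightarrow> (x', y') \<in> R \<Longrightarrow> \<bar>mdist X x x' - mdist Y y y'\<bar> \<le> 2 * \<delta>"
  shows "gh_distance X Y \<le> \<delta>"
proof (rule dense_ge)
  fix r assume r: "\<delta> < r"
  have "r \<in> gh_bounds X Y"
  proof (rule gh_boundsI[OF R])
    show "mspace X \<noteq> {}"
      using b(1) by (simp add: bounded_metric_def)
  qed (use r \<delta> dis in force)+
  then show "gh_distance X Y \<le> r"
    unfolding gh_distance_eq_Inf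
    using gh_bounds_nonneg[OF b] by (intro cInf_lower bdd_belowI)
qed

text \<open>Points whose copies lie closer than \<open>s < r\<close> in an ambient space are
  related; two such pairs change a distance by at most \<open>2 * s\<close>. The strict hypothesis
  leaves room for infima that are not attained.\<close>

lemma gh_distance_lessE:
  fixes X :: "'a metric" and Y :: "'b metric"
  assumes b: "bounded_metric X" "bounded_metric Y" and r: "gh_distance X Y < r"
  obtains R where "R \<subseteq> mspace X \<times> mspace Y" "mspace X \<subseteq> Domain R" "mspace Y \<subseteq> Range R"
    "\<And>x y x' y'. (x, y) \<in> R \<Longrightarrow> (x', y') \<in> R \<Longrightarrow> \<bar>mdist X x x' - mdist Y y y'\<bar> \<le> 2 * r"
proof -
  obtain q where q: "q \<in> gh_bounds X Y" "q < r"
    using cInf_lessD[OF gh_bounds_nonempty[OF b]] r unfolding gh_distance_eq_Inf by blast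
  then obtain Z :: "('a + 'b) metric" and X' Y' where
    Z: "X' \<subseteq> mspace Z" "Y' \<subseteq> mspace Z" "isometric (submetric Z X') X"
      "isometric (submetric Z Y') Y" "hausdorff_dist Z X' Y' < r"
    unfolding gh_bounds_def by fastforce
  have "bounded_metric (submetric Z X')" "bounded_metric (submetric Z Y')"
    using bounded_metric_isometric[OF isometric_sym] Z b by blast+
  then obtain s where s: "s < r" "X' \<subseteq> (\<Union>b\<in>Y'. mball_of Z b s)" "Y' \<subseteq> (\<Union>a\<in>X'. mball_of Z a s)"
    using hausdorff_dist_lessE[OF Z(1) _ Z(2) _ Z(5)] by blast
  have ms: "mspace (submetric Z X') = X'" "mspace (submetric Z Y') = Y'"
    using Z by auto
  obtain f where f: "f ` X' = mspace X" "\<forall>x\<in>X'. \<forall>y\<in>X'. mdist X (f x) (f y) = mdist Z x y"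
    using Z(3) ms unfolding isometric_def by (metis mdist_submetric)
  obtain g where g: "g ` Y' = mspace Y" "\<forall>x\<in>Y'. \<forall>y\<in>Y'. mdist Y (g x) (g y) = mdist Z x y"
    using Z(4) ms unfolding isometric_def by (metis mdist_submetric)
  define R where "R = {(f x, g y) | x y. x \<in> X' \<and> y \<in> Y' \<and> mdist Z x y < s}"
  show ?thesis
  proof (rule that)
    show "R \<subseteq> mspace X \<times> mspace Y"
      using f(1) g(1) by (auto simp: R_def)
    show "mspace X \<subseteq> Domain R"
    proof
      fix x assume "x \<in> mspace X"
      then obtain u where u: "u \<in> X'" "x = f u"
        using f(1) by blast
      obtain v where v: "v \<in> Y'" "u \<in> mball_of Z v s"
        using s(2) u(1) by blast
      have "mdist Z u v < s"
        using v(2) mdist_commute[of Z u v] by simp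
      then have "(x, g v) \<in> R"
        using u v(1) unfolding R_def by blast
      then show "x \<in> Domain R"
        by blast
    qed
    show "mspace Y \<subseteq> Range R"
    proof
      fix y assume "y \<in> mspace Y"
      then obtain v where v: "v \<in> Y'" "y = g v"
        using g(1) by blast
      obtain u where u: "u \<in> X'" "v \<in> mball_of Z u s"
        using s(3) v(1) by blast
      have "mdist Z u v < s"
        using u(2) by simp
      then have "(f u, y) \<in> R"
        using v u(1) unfolding R_def by blast
      then show "y \<in> Range R"
        by blast
    qed
    fix x y x' y' assume "(x, y) \<in> R" "(x', y') \<in> R"
    then obtain u v u' v' where uv: "u \<in> X'" "v \<in> Y'" "x = f u" "y = g v" "mdist Z u v < s"
      and uv': "u' \<in> X'" "v' \<in> Y'" "x' = f u'" "y' = g v'" "mdist Z u' v' < s"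
      unfolding R_def by blast
    have "mdist Z u u' \<le> mdist Z u v + mdist Z v u'" "mdist Z v u' \<le> mdist Z v v' + mdist Z v' u'"
      "mdist Z v v' \<le> mdist Z v u + mdist Z u v'" "mdist Z u v' \<le> mdist Z u u' + mdist Z u' v'"
      using uv uv' Z by (auto intro!: mdist_triangle)
    then have "\<bar>mdist Z u u' - mdist Z v v'\<bar> \<le> 2 * r"
      using uv(5) uv'(5) s(1) mdist_commute[of Z v u] mdist_commute[of Z v' u'] by linarith
    then show "\<bar>mdist X x x' - mdist Y y y'\<bar> \<le> 2 * r"
      using f(2) g(2) uv uv' by simp
  qed
qed

section \<open>Pseudometrics on a finite set\<close>

text \<open>Fixing the value 0 off \<open>I \<times> I\<close> leaves no free coordinates, which
  would destroy compactness of closed balls in the product topology. Nonnegativity follows from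
  symmetry and the triangle inequality.\<close>

definition pseudometrics :: "'i set \<Rightarrow> ('i \<times> 'i \<Rightarrow> real) set" where
  "pseudometrics I = {\<rho>. (\<forall>z. z \<notin> I \<times> I \<longrightarrow> \<rho> z = 0) \<and> (\<forall>i\<in>I. \<rho> (i, i) = 0) \<and>
    (\<forall>i\<in>I. \<forall>j\<in>I. \<rho> (i, j) = \<rho> (j, i)) \<and>
    (\<forall>i\<in>I. \<forall>j\<in>I. \<forall>k\<in>I. \<rho> (i, k) \<le> \<rho> (i, j) + \<rho> (j, k))}"

text \<open>Matching points with the same index is a correspondence between the two quotients, and
  the maximum is its distortion.\<close>

definition half_sup_dist :: "'i set \<Rightarrow> ('i \<times> 'i \<Rightarrow> real) \<Rightarrow> ('i \<times> 'i \<Rightarrow> real) \<Rightarrow> real" where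
  "half_sup_dist I \<rho> \<sigma> = Max ((\<lambda>z. \<bar>\<rho> z - \<sigma> z\<bar>) ` (I \<times> I)) / 2"

lemma half_sup_dist_le_iff:
  assumes "finite I" "I \<noteq> {}"
  shows "half_sup_dist I \<rho> \<sigma> \<le> c \<longleftrightarrow> (\<forall>z\<in>I \<times> I. \<bar>\<rho> z - \<sigma> z\<bar> \<le> 2 * c)"
proof -
  have "half_sup_dist I \<rho> \<sigma> \<le> c \<longleftrightarrow> Max ((\<lambda>z. \<bar>\<rho> z - \<sigma> z\<bar>) ` (I \<times> I)) \<le> 2 * c"
    by (auto simp: half_sup_dist_def)
  also have "\<dots> \<longleftrightarrow> (\<forall>z\<in>I \<times> I. \<bar>\<rho> z - \<sigma> z\<bar> \<le> 2 * c)"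
    using assms by (subst Max_le_iff) auto
  finally show ?thesis .
qed

lemma half_sup_dist_ge:
  assumes "finite I" "I \<noteq> {}" "z \<in> I \<times> I"
  shows "\<bar>\<rho> z - \<sigma> z\<bar> \<le> 2 * half_sup_dist I \<rho> \<sigma>"
  using half_sup_dist_le_iff[OF assms(1,2), of \<rho> \<sigma> "half_sup_dist I \<rho> \<sigma>"] assms(3) by blast

lemma half_sup_dist_nonneg:
  assumes "finite I" "I \<noteq> {}"
  shows "0 \<le> half_sup_dist I \<rho> \<sigma>"
proof -
  obtain i where "i \<in> I" using assms by blast
  then show ?thesis
    using half_sup_dist_ge[OF assms, of "(i, i)" \<rho> \<sigma>] by auto
qed

lemma continuous_on_Max_image:
  fixes f :: "'k \<Rightarrow> 'a::topological_space \<Rightarrow> 'b::linorder_topology"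
  assumes "finite K" "K \<noteq> {}" "\<And>k. k \<in> K \<Longrightarrow> continuous_on S (f k)"
  shows "continuous_on S (\<lambda>x. Max ((\<lambda>k. f k x) ` K))"
  using assms
proof (induction K rule: finite_ne_induct)
  case (insert k K)
  then have "continuous_on S (\<lambda>x. max (f k x) (Max ((\<lambda>k. f k x) ` K)))"
    by (intro continuous_on_max) auto
  then show ?case
    using insert.hyps by simp
qed simp

lemma compact_PiE_UNIV:
  fixes K :: "'k \<Rightarrow> 'a::topological_space set"
  assumes "\<And>k. compact (K k)"
  shows "compact (PiE UNIV K)"
proof -
  have "compactin (product_topology (\<lambda>_. euclidean) UNIV) (PiE UNIV K)"
    using assms by (simp add: compactin_PiE)
  then show ?thesis
    by (simp add: euclidean_product_topology)
qed

text \<open>By Tychonoff's theorem the product of the coordinate intervals is compact; the axioms of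
  a pseudometric are closed conditions on finitely many coordinates.\<close>

lemma compact_pseudometrics_cball:
  assumes "finite I" "I \<noteq> {}" "\<rho> \<in> pseudometrics I"
  shows "compact {\<sigma> \<in> pseudometrics I. half_sup_dist I \<rho> \<sigma> \<le> C}"
proof -
  let ?K = "\<lambda>z. if z \<in> I \<times> I then {\<rho> z - 2 * C .. \<rho> z + 2 * C} else {0}"
  define F where "F = (\<Inter>i\<in>I. {\<sigma> :: 'a \<times> 'a \<Rightarrow> real. \<sigma> (i, i) = 0}) \<inter>
      (\<Inter>i\<in>I. \<Inter>j\<in>I. {\<sigma>. \<sigma> (i, j) = \<sigma> (j, i)}) \<inter>
      (\<Inter>i\<in>I. \<Inter>j\<in>I. \<Inter>k\<in>I. {\<sigma>. \<sigma> (i, k) \<le> \<sigma> (i, j) + \<sigma> (j, k)})"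
  have "closed F"
    unfolding F_def
    by (intro closed_Int closed_INT ballI closed_Collect_eq closed_Collect_le continuous_intros
        continuous_on_product_coordinates)
  moreover have "compact (PiE UNIV ?K)"
    by (rule compact_PiE_UNIV) simp
  ultimately have "compact (PiE UNIV ?K \<inter> F)"
    by (simp add: compact_Int_closed)
  moreover have "\<sigma> \<in> pseudometrics I \<and> half_sup_dist I \<rho> \<sigma> \<le> C \<longleftrightarrow> \<sigma> \<in> PiE UNIV ?K \<inter> F" for \<sigma>
  proof -
    have "\<sigma> z \<in> ?K z \<longleftrightarrow> (z \<notin> I \<times> I \<longrightarrow> \<sigma> z = 0) \<and> (z \<in> I \<times> I \<longrightarrow> \<bar>\<rho> z - \<sigma> z\<bar> \<le> 2 * C)" for z
    proof (cases "z \<in> I \<times> I")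
      case True
      then show ?thesis
        unfolding if_P[OF True] atLeastAtMost_iff by linarith
    qed simp
    then have "\<sigma> \<in> PiE UNIV ?K \<longleftrightarrow>
        (\<forall>z. z \<notin> I \<times> I \<longrightarrow> \<sigma> z = 0) \<and> (\<forall>z\<in>I \<times> I. \<bar>\<rho> z - \<sigma> z\<bar> \<le> 2 * C)"
      unfolding PiE_UNIV_domain Pi_iff by blast
    then show ?thesis
      unfolding half_sup_dist_le_iff[OF assms(1,2)] pseudometrics_def F_def by auto
  qed
  ultimately show ?thesis
    by (simp only: Collect_mem_eq)
qed

lemma proper_space_pseudometrics:
  assumes I: "finite I" "I \<noteq> {}"
  shows "proper_space (pseudometrics I) (half_sup_dist I)"
proof
  fix \<rho> \<sigma> \<tau> :: "'a \<times> 'a \<Rightarrow> real" and C :: real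
  show "0 \<le> half_sup_dist I \<rho> \<sigma>"
    using half_sup_dist_nonneg[OF I] .
  show "half_sup_dist I \<rho> \<rho> = 0"
    using half_sup_dist_le_iff[OF I, of \<rho> \<rho> 0] half_sup_dist_nonneg[OF I, of \<rho> \<rho>] by simp
  show "half_sup_dist I \<rho> \<sigma> = half_sup_dist I \<sigma> \<rho>"
    by (simp add: half_sup_dist_def abs_minus_commute)
  show "half_sup_dist I \<rho> \<tau> \<le> half_sup_dist I \<rho> \<sigma> + half_sup_dist I \<sigma> \<tau>"
    unfolding half_sup_dist_le_iff[OF I]
  proof
    fix z assume z: "z \<in> I \<times> I"
    show "\<bar>\<rho> z - \<tau> z\<bar> \<le> 2 * (half_sup_dist I \<rho> \<sigma> + half_sup_dist I \<sigma> \<tau>)"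
      using half_sup_dist_ge[OF I z, of \<rho> \<sigma>] half_sup_dist_ge[OF I z, of \<sigma> \<tau>]
      unfolding distrib_left by linarith
  qed
  show "continuous_on (pseudometrics I) (half_sup_dist I \<rho>)"
    unfolding half_sup_dist_def using I
    by (intro continuous_intros continuous_on_Max_image continuous_on_subset[OF continuous_on_product_coordinates]) auto
  show "compact {\<sigma> \<in> pseudometrics I. half_sup_dist I \<rho> \<sigma> \<le> C}" if "\<rho> \<in> pseudometrics I"
    using compact_pseudometrics_cball[OF I that] .
qed

section \<open>Pullbacks and metric quotients\<close>

definition pullback_metric :: "'i set \<Rightarrow> 'a metric \<Rightarrow> ('i \<Rightarrow> 'a) \<Rightarrow> 'i \<times> 'i \<Rightarrow> real" where
  "pullback_metric I X g = (\<lambda>(i, j). if i \<in> I \<and> j \<in> I then mdist X (g i) (g j) else 0)"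

lemma pullback_metric_apply:
  "i \<in> I \<Longrightarrow> j \<in> I \<Longrightarrow> pullback_metric I X g (i, j) = mdist X (g i) (g j)"
  by (simp add: pullback_metric_def)

lemma pullback_metric_cong:
  "(\<And>i. i \<in> I \<Longrightarrow> g i = h i) \<Longrightarrow> pullback_metric I X g = pullback_metric I X h"
  by (auto simp: pullback_metric_def)

lemma pullback_metric_pseudometrics:
  assumes "g ` I \<subseteq> mspace X"
  shows "pullback_metric I X g \<in> pseudometrics I"
  using assms unfolding pseudometrics_def
  by (auto simp: pullback_metric_def mdist_commute image_subset_iff intro!: mdist_triangle)

lemma finite_compact_metrics:
  assumes "finite (mspace X)" "mspace X \<noteq> {}"
  shows "X \<in> compact_metrics"
  using assms by (simp add: compact_metrics_def compact_space_def finite_imp_compactin)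

text \<open>The metric quotient is built on representatives inside \<open>I\<close> rather than on
  sets of indices, and is then transported to real points like any compact space.\<close>

lemma pseudometric_realization:
  fixes I :: "'i set"
  assumes I: "finite I" "I \<noteq> {}" and \<rho>: "\<rho> \<in> pseudometrics I"
  shows "\<exists>(X :: real metric) g. g ` I = mspace X \<and> \<rho> = pullback_metric I X g"
proof -
  have out: "\<And>z. z \<notin> I \<times> I \<Longrightarrow> \<rho> z = 0" and zero: "\<And>i. i \<in> I \<Longrightarrow> \<rho> (i, i) = 0"
    and com: "\<And>i j. i \<in> I \<Longrightarrow> j \<in> I \<Longrightarrow> \<rho> (i, j) = \<rho> (j, i)"
    and tri: "\<And>i j k. i \<in> I \<Longrightarrow> j \<in> I \<Longrightarrow> k \<in> I \<Longrightarrow> \<rho> (i, k) \<le> \<rho> (i, j) + \<rho> (j, k)"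
    using \<rho> by (auto simp: pseudometrics_def)
  have nn: "0 \<le> \<rho> z" for z
  proof (cases "z \<in> I \<times> I")
    case True
    then obtain i j where "z = (i, j)" "i \<in> I" "j \<in> I" by blast
    then show ?thesis
      using tri[of i j i] zero com[of i j] by simp
  qed (simp add: out)
  have com': "\<rho> (i, j) = \<rho> (j, i)" for i j
    using com[of i j] out[of "(i, j)"] out[of "(j, i)"] by (cases "i \<in> I \<and> j \<in> I") auto
  \<comment> \<open>Indices at distance 0 satisfy the same predicate under \<open>SOME\<close>, so
    \<open>q\<close> selects one representative in each class.\<close>
  define q where "q i = (SOME j. j \<in> I \<and> \<rho> (i, j) = 0)" for i
  have q: "q i \<in> I" "\<rho> (i, q i) = 0" if "i \<in> I" for i
    using someI[of "\<lambda>j. j \<in> I \<and> \<rho> (i, j) = 0" i] that zero by (auto simp: q_def)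
  have \<rho>q: "\<rho> (q i, q j) = \<rho> (i, j)" if ij: "i \<in> I" "j \<in> I" for i j
  proof -
    note q' = q[OF ij(1)] q[OF ij(2)]
    have "\<rho> (q i, q j) \<le> \<rho> (q i, i) + \<rho> (i, q j)" "\<rho> (i, q j) \<le> \<rho> (i, j) + \<rho> (j, q j)"
      "\<rho> (i, j) \<le> \<rho> (i, q i) + \<rho> (q i, j)" "\<rho> (q i, j) \<le> \<rho> (q i, q j) + \<rho> (q j, j)"
      by (rule tri; fact q' ij)+
    then show ?thesis
      using q' com'[of "q i" i] com'[of "q j" j] by linarith
  qed
  have q_eq: "q i = q j" if ij: "i \<in> I" "j \<in> I" "\<rho> (i, j) = 0" for i j
  proof -
    have "k \<in> I \<and> \<rho> (i, k) = 0 \<longleftrightarrow> k \<in> I \<and> \<rho> (j, k) = 0" for k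
      using tri[of i j k] tri[of j i k] ij com'[of i j] nn[of "(i, k)"] nn[of "(j, k)"] by auto
    then show ?thesis
      by (simp add: q_def)
  qed
  have m: "Metric_space (q ` I) (\<lambda>i j. \<rho> (i, j))"
  proof
    show "\<rho> (i, j) = 0 \<longleftrightarrow> i = j" if ij: "i \<in> q ` I" "j \<in> q ` I" for i j
    proof -
      obtain a b where ab: "i = q a" "a \<in> I" "j = q b" "b \<in> I"
        using ij by blast
      have "\<rho> (q a, q b) = 0 \<Longrightarrow> q a = q b" "\<rho> (q b, q b) = 0"
        using \<rho>q[OF ab(2,4)] q_eq[OF ab(2,4)] zero[OF q(1)[OF ab(4)]] by simp_all
      then show ?thesis
        unfolding ab by metis
    qed
    show "\<rho> (i, k) \<le> \<rho> (i, j) + \<rho> (j, k)" if "i \<in> q ` I" "j \<in> q ` I" "k \<in> q ` I" for i j k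
      using that q(1) by (intro tri) blast+
  qed (rule nn com')+
  define Q where "Q = metric (q ` I, \<lambda>i j. \<rho> (i, j))"
  have Q: "mspace Q = q ` I" "mdist Q = (\<lambda>i j. \<rho> (i, j))"
    unfolding Q_def using Metric_space.mspace_metric[OF m] Metric_space.mdist_metric[OF m] by auto
  have "compact_space (mtopology_of Q)"
    using I Q by (simp add: compact_space_def finite_imp_compactin)
  then obtain X :: "real metric" where "isometric Q X"
    using compact_metric_isometric_real by blast
  then obtain f where f: "f ` q ` I = mspace X"
    "\<forall>x\<in>q ` I. \<forall>y\<in>q ` I. mdist X (f x) (f y) = \<rho> (x, y)"
    unfolding isometric_def Q by blast
  have "\<rho> = pullback_metric I X (f \<circ> q)"
  proof
    fix z :: "'i \<times> 'i"
    obtain i j where z: "z = (i, j)" by force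
    show "\<rho> z = pullback_metric I X (f \<circ> q) z"
      using f(2) \<rho>q[of i j] out[of z] unfolding z by (auto simp: pullback_metric_def)
  qed
  moreover have "(f \<circ> q) ` I = mspace X"
    using f(1) by (simp add: image_comp)
  ultimately show ?thesis
    by blast
qed

lemma gh_distance_pullback_le:
  assumes I: "finite I" "I \<noteq> {}" and g: "g ` I = mspace X" and h: "h ` I = mspace Y"
  shows "gh_distance X Y \<le> half_sup_dist I (pullback_metric I X g) (pullback_metric I Y h)"
proof (rule gh_distance_le)
  let ?R = "(\<lambda>i. (g i, h i)) ` I"
  have *: "bounded_metric Z" if k: "k ` I = mspace Z" for k and Z :: "'z metric"
  proof -
    have "\<forall>x\<in>mspace Z. \<forall>y\<in>mspace Z. mdist Z x y \<le> Max (case_prod (mdist Z) ` (mspace Z \<times> mspace Z))"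
      using I k[symmetric] by (intro ballI Max_ge) auto
    then show ?thesis
      using I k unfolding bounded_metric_def by blast
  qed
  show "bounded_metric X" "bounded_metric Y"
    using *[OF g] *[OF h] .
  show "?R \<subseteq> mspace X \<times> mspace Y" "mspace X \<subseteq> Domain ?R" "mspace Y \<subseteq> Range ?R"
    unfolding g[symmetric] h[symmetric] by force+
  show "0 \<le> half_sup_dist I (pullback_metric I X g) (pullback_metric I Y h)"
    using half_sup_dist_nonneg[OF I] .
  fix x y x' y' assume "(x, y) \<in> ?R" "(x', y') \<in> ?R"
  then obtain i j where "i \<in> I" "j \<in> I" "x = g i" "y = h i" "x' = g j" "y' = h j"
    by blast
  then show "\<bar>mdist X x x' - mdist Y y y'\<bar> \<le>
      2 * half_sup_dist I (pullback_metric I X g) (pullback_metric I Y h)"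
    using half_sup_dist_ge[OF I, of "(i, j)" "pullback_metric I X g" "pullback_metric I Y h"]
    by (simp add: pullback_metric_apply)
qed

text \<open>Sending \<open>g i\<close> to \<open>h i\<close> is well defined: indices with equal
  image under \<open>g\<close> have pulled-back distance 0, hence equal image under
  \<open>h\<close>.\<close>

lemma pullback_metric_isometric:
  assumes g: "g ` I = mspace X" and h: "h ` I = mspace Y"
    and eq: "pullback_metric I X g = pullback_metric I Y h"
  shows "isometric X Y"
proof -
  have d: "mdist X (g i) (g j) = mdist Y (h i) (h j)" if "i \<in> I" "j \<in> I" for i j
    using fun_cong[OF eq, of "(i, j)"] that by (simp add: pullback_metric_apply)
  define f where "f x = h (inv_into I g x)" for x
  have f: "f (g i) = h i" if i: "i \<in> I" for i
  proof -
    have k: "inv_into I g (g i) \<in> I" "g (inv_into I g (g i)) = g i"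
      using i by (auto intro: inv_into_into f_inv_into_f)
    have "mdist Y (f (g i)) (h i) = mdist X (g i) (g i)"
      using d[OF k(1) i] k(2) by (simp add: f_def)
    moreover have "f (g i) \<in> mspace Y" "h i \<in> mspace Y" "g i \<in> mspace X"
      using k(1) i g h by (auto simp: f_def)
    ultimately show ?thesis
      by (metis mdist_zero)
  qed
  show ?thesis
    unfolding isometric_def
  proof (intro exI[of _ f] conjI)
    show "f ` mspace X = mspace Y"
      unfolding g[symmetric] h[symmetric] using f by (force simp: image_comp)
    show "\<forall>x\<in>mspace X. \<forall>y\<in>mspace X. mdist Y (f x) (f y) = mdist X x y"
      unfolding g[symmetric] using f d by auto
  qed
qed

text \<open>\<open>quotient_class I \<rho>\<close> is the point of the Gromov--Hausdorff space given by the metric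
  quotient of \<open>(I, \<rho>)\<close>; the description under \<open>SOME\<close> is satisfiable only for
  \<open>\<rho>\<close> in \<open>pseudometrics I\<close>.\<close>

definition quotient_class :: "'i set \<Rightarrow> ('i \<times> 'i \<Rightarrow> real) \<Rightarrow> real metric set" where
  "quotient_class I \<rho> =
    isometry_rel `` {SOME X. \<exists>g. g ` I = mspace X \<and> \<rho> = pullback_metric I X g}"

lemma quotient_class_obtain:
  assumes I: "finite I" "I \<noteq> {}" and \<rho>: "\<rho> \<in> pseudometrics I"
  obtains X g where "X \<in> compact_metrics" "g ` I = mspace X" "\<rho> = pullback_metric I X g"
    "quotient_class I \<rho> = isometry_rel `` {X}"
proof -
  define X :: "real metric" where "X = (SOME X. \<exists>g. g ` I = mspace X \<and> \<rho> = pullback_metric I X g)"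
  have "\<exists>g. g ` I = mspace X \<and> \<rho> = pullback_metric I X g"
    unfolding X_def using pseudometric_realization[OF assms] by (rule someI_ex)
  then obtain g where g: "g ` I = mspace X" "\<rho> = pullback_metric I X g" by blast
  moreover have "X \<in> compact_metrics"
    using finite_compact_metrics[of X] I g(1)[symmetric] by simp
  moreover have "quotient_class I \<rho> = isometry_rel `` {X}"
    unfolding quotient_class_def X_def ..
  ultimately show ?thesis
    using that by blast
qed

lemma quotient_class_gh_space:
  assumes "finite I" "I \<noteq> {}" "\<rho> \<in> pseudometrics I"
  shows "quotient_class I \<rho> \<in> gh_space"
proof -
  obtain X where "X \<in> compact_metrics" "quotient_class I \<rho> = isometry_rel `` {X}"
    using quotient_class_obtain[OF assms] .
  then show ?thesis
    by (simp add: gh_space_def quotientI)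
qed

lemma gh_dist_quotient_class_le:
  assumes I: "finite I" "I \<noteq> {}" and "\<rho> \<in> pseudometrics I" "\<sigma> \<in> pseudometrics I"
  shows "gh_dist (quotient_class I \<rho>) (quotient_class I \<sigma>) \<le> half_sup_dist I \<rho> \<sigma>"
proof -
  obtain X g where X: "X \<in> compact_metrics" "g ` I = mspace X" "\<rho> = pullback_metric I X g"
    "quotient_class I \<rho> = isometry_rel `` {X}"
    using quotient_class_obtain[OF I assms(3)] .
  obtain Y h where Y: "Y \<in> compact_metrics" "h ` I = mspace Y" "\<sigma> = pullback_metric I Y h"
    "quotient_class I \<sigma> = isometry_rel `` {Y}"
    using quotient_class_obtain[OF I assms(4)] .
  show ?thesis
    using gh_distance_pullback_le[OF I X(2) Y(2)] gh_dist_class[OF X(1) Y(1)]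
    unfolding X(4) Y(4) X(3)[symmetric] Y(3)[symmetric] by simp
qed

text \<open>The realization chosen in \<open>quotient_class\<close> may differ from \<open>X\<close>
  but is isometric to it. This brings the terminals back to their original classes.\<close>

lemma quotient_class_pullback:
  assumes I: "finite I" "I \<noteq> {}" and X: "X \<in> compact_metrics" "g ` I = mspace X"
  shows "quotient_class I (pullback_metric I X g) = isometry_rel `` {X}"
proof -
  have \<rho>: "pullback_metric I X g \<in> pseudometrics I"
    using X by (intro pullback_metric_pseudometrics) simp
  obtain Y h where Y: "Y \<in> compact_metrics" "h ` I = mspace Y"
    "pullback_metric I X g = pullback_metric I Y h"
    "quotient_class I (pullback_metric I X g) = isometry_rel `` {Y}"
    using quotient_class_obtain[OF I \<rho>] .
  have "isometric Y X"
    using pullback_metric_isometric[OF Y(2) X(2)] Y(3) by simp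
  then have "(Y, X) \<in> isometry_rel"
    using X Y by (simp add: isometry_rel_def)
  then show ?thesis
    using equiv_class_eq[OF equiv_isometry_rel] Y(4) by simp
qed

section \<open>Lifting graphs to pseudometrics\<close>

text \<open>A section picks a point of the space \<open>X u\<close> at every vertex \<open>u\<close>, compatibly with
  correspondences chosen along the edges; since the graph is a tree, there is a section through
  every point.\<close>

definition tree_sections ::
    "('v \<Rightarrow> 'a metric) \<Rightarrow> ('v \<Rightarrow> 'v \<Rightarrow> real) \<Rightarrow> 'v set \<Rightarrow> 'v set set \<Rightarrow> ('v \<Rightarrow> 'a) set \<Rightarrow> bool" where
  "tree_sections X D V E \<Sigma> \<longleftrightarrow> (\<forall>s\<in>\<Sigma>. \<forall>u\<in>V. s u \<in> mspace (X u)) \<and>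
    (\<forall>u\<in>V. \<forall>x\<in>mspace (X u). \<exists>s\<in>\<Sigma>. s u = x) \<and>
    (\<forall>u v s t. {u, v} \<in> E \<longrightarrow> s \<in> \<Sigma> \<longrightarrow> t \<in> \<Sigma> \<longrightarrow>
      \<bar>mdist (X u) (s u) (t u) - mdist (X v) (s v) (t v)\<bar> \<le> 2 * D u v)"

text \<open>Two sections are glued when their values at the two roots are related by
  \<open>R\<close>. As \<open>R\<close> relates every point on either side, each section over one
  tree has a partner over the other. Around a cycle the correspondences need not close up, which is
  why a tree is required.\<close>

lemma rooted_tree_sections:
  fixes X :: "'v \<Rightarrow> 'a metric"
  assumes "rooted_tree r V E" and "\<And>v. v \<in> V \<Longrightarrow> bounded_metric (X v)"
    and "\<And>u v. u \<in> V \<Longrightarrow> v \<in> V \<Longrightarrow> gh_distance (X u) (X v) < D u v" and sym: "\<And>u v. D u v = D v u"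
  shows "\<exists>\<Sigma>. tree_sections X D V E \<Sigma>"
  using assms(1-3)
proof (induction rule: rooted_tree.induct)
  case (vertex r)
  show ?case
    by (rule exI[of _ "{s. s r \<in> mspace (X r)}"]) (auto simp: tree_sections_def)
next
  case (join r V E w V' E')
  have "\<exists>\<Sigma>. tree_sections X D V E \<Sigma>"
    by (rule join.IH(1)) (use join.prems in simp_all)
  then obtain \<Sigma>1 where "tree_sections X D V E \<Sigma>1" ..
  then have 1: "\<forall>s\<in>\<Sigma>1. \<forall>u\<in>V. s u \<in> mspace (X u)"
    "\<forall>u\<in>V. \<forall>x\<in>mspace (X u). \<exists>s\<in>\<Sigma>1. s u = x"
    "\<And>u v s t. {u, v} \<in> E \<Longrightarrow> s \<in> \<Sigma>1 \<Longrightarrow> t \<in> \<Sigma>1 \<Longrightarrow>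
      \<bar>mdist (X u) (s u) (t u) - mdist (X v) (s v) (t v)\<bar> \<le> 2 * D u v"
    unfolding tree_sections_def by simp_all
  have "\<exists>\<Sigma>. tree_sections X D V' E' \<Sigma>"
    by (rule join.IH(2)) (use join.prems in simp_all)
  then obtain \<Sigma>2 where "tree_sections X D V' E' \<Sigma>2" ..
  then have 2: "\<forall>s\<in>\<Sigma>2. \<forall>u\<in>V'. s u \<in> mspace (X u)"
    "\<forall>u\<in>V'. \<forall>x\<in>mspace (X u). \<exists>s\<in>\<Sigma>2. s u = x"
    "\<And>u v s t. {u, v} \<in> E' \<Longrightarrow> s \<in> \<Sigma>2 \<Longrightarrow> t \<in> \<Sigma>2 \<Longrightarrow>
      \<bar>mdist (X u) (s u) (t u) - mdist (X v) (s v) (t v)\<bar> \<le> 2 * D u v"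
    unfolding tree_sections_def by simp_all
  have rw: "r \<in> V" "w \<in> V'" "w \<notin> V"
    using rooted_tree_graph[OF join.hyps(1)] rooted_tree_graph[OF join.hyps(2)] join.hyps(3) by blast+
  have b: "bounded_metric (X r)" "bounded_metric (X w)" "gh_distance (X r) (X w) < D r w"
    using join.prems rw by simp_all
  obtain R where R: "R \<subseteq> mspace (X r) \<times> mspace (X w)" "mspace (X r) \<subseteq> Domain R"
    "mspace (X w) \<subseteq> Range R"
    "\<And>x y x' y'. (x, y) \<in> R \<Longrightarrow> (x', y') \<in> R \<Longrightarrow> \<bar>mdist (X r) x x' - mdist (X w) y y'\<bar> \<le> 2 * D r w"
    using gh_distance_lessE[OF b] by blast
  note dE = 1(3) and dE' = 2(3)
  define glue where "glue s s' = (\<lambda>u. if u \<in> V then s u else s' u)" for s s' :: "'v \<Rightarrow> 'a"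
  define \<Sigma> where "\<Sigma> = {glue s s' | s s'. s \<in> \<Sigma>1 \<and> s' \<in> \<Sigma>2 \<and> (s r, s' w) \<in> R}"
  have E: "u \<in> V \<and> v \<in> V" if "{u, v} \<in> E" for u v
    using that rooted_tree_graph[OF join.hyps(1)] by blast
  have E': "u \<notin> V \<and> v \<notin> V" if "{u, v} \<in> E'" for u v
  proof -
    have "\<forall>e\<in>E'. e \<subseteq> V'"
      using rooted_tree_graph[OF join.hyps(2)] by simp
    then have "{u, v} \<subseteq> V'"
      using that by (rule bspec)
    then show ?thesis
      using join.hyps(3) by auto
  qed
  have "s u \<in> mspace (X u)" if "s \<in> \<Sigma>" "u \<in> V \<union> V'" for s u
    using that 1(1) 2(1) by (auto simp: \<Sigma>_def glue_def)
  moreover have "\<exists>s\<in>\<Sigma>. s u = x" if u: "u \<in> V \<union> V'" and x: "x \<in> mspace (X u)" for u x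
  proof (cases "u \<in> V")
    case True
    then obtain s where s: "s \<in> \<Sigma>1" "s u = x"
      using 1(2) x by blast
    have "s r \<in> Domain R"
      using R(2) 1(1) s(1) rw(1) by blast
    then obtain y where y: "(s r, y) \<in> R"
      by blast
    then have "y \<in> mspace (X w)"
      using R(1) by blast
    then obtain s' where s': "s' \<in> \<Sigma>2" "s' w = y"
      using 2(2) rw(2) by blast
    have "(s r, s' w) \<in> R"
      using y s'(2) by simp
    then have "glue s s' \<in> \<Sigma>"
      unfolding \<Sigma>_def using s(1) s'(1) by blast
    moreover have "glue s s' u = x"
      using s(2) True by (simp add: glue_def)
    ultimately show ?thesis by blast
  next
    case False
    then have "u \<in> V'" using u by blast
    then obtain s' where s': "s' \<in> \<Sigma>2" "s' u = x"
      using 2(2) x by blast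
    have "s' w \<in> Range R"
      using R(3) 2(1) s'(1) rw(2) by blast
    then obtain y where y: "(y, s' w) \<in> R"
      by blast
    then have "y \<in> mspace (X r)"
      using R(1) by blast
    then obtain s where s: "s \<in> \<Sigma>1" "s r = y"
      using 1(2) rw(1) by blast
    have "(s r, s' w) \<in> R"
      using y s(2) by simp
    then have "glue s s' \<in> \<Sigma>"
      unfolding \<Sigma>_def using s(1) s'(1) by blast
    moreover have "glue s s' u = x"
      using s'(2) False by (simp add: glue_def)
    ultimately show ?thesis by blast
  qed
  moreover have "\<bar>mdist (X u) (s u) (t u) - mdist (X v) (s v) (t v)\<bar> \<le> 2 * D u v"
    if e: "{u, v} \<in> insert {r, w} (E \<union> E')" and st: "s \<in> \<Sigma>" "t \<in> \<Sigma>" for u v s t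
  proof -
    obtain s1 s2 where s: "s = glue s1 s2" "s1 \<in> \<Sigma>1" "s2 \<in> \<Sigma>2" "(s1 r, s2 w) \<in> R"
      using st unfolding \<Sigma>_def by blast
    obtain t1 t2 where t: "t = glue t1 t2" "t1 \<in> \<Sigma>1" "t2 \<in> \<Sigma>2" "(t1 r, t2 w) \<in> R"
      using st unfolding \<Sigma>_def by blast
    consider "{u, v} = {r, w}" | "{u, v} \<in> E" | "{u, v} \<in> E'"
      using e by blast
    then consider "{u, v} \<in> E" | "{u, v} \<in> E'" | "u = r" "v = w" | "u = w" "v = r"
      by cases (auto simp only: doubleton_eq_iff)
    then show ?thesis
    proof cases
      case 1
      then show ?thesis
        using dE[OF 1 s(2) t(2)] E[OF 1] s(1) t(1)
        by (simp add: glue_def)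
    next
      case 2
      then show ?thesis
        using dE'[OF 2 s(3) t(3)] E'[OF 2] s(1) t(1)
        by (simp add: glue_def)
    next
      case 3
      then show ?thesis
        using R(4)[OF s(4) t(4)] s(1) t(1) rw by (simp add: glue_def)
    next
      case 4
      then show ?thesis
        using R(4)[OF s(4) t(4)] s(1) t(1) rw sym[of r w] by (simp add: glue_def abs_minus_commute)
    qed
  qed
  ultimately show ?case
    unfolding tree_sections_def by (intro exI[of _ \<Sigma>] conjI ballI allI impI)
qed

section \<open>Representatives of isometry classes and the lifted tree\<close>

definition class_rep :: "real metric set \<Rightarrow> real metric" where
  "class_rep c = (SOME X. X \<in> c)"

lemma class_rep_gh_space:
  assumes "c \<in> gh_space"
  shows "class_rep c \<in> c" "class_rep c \<in> compact_metrics" "isometry_rel `` {class_rep c} = c"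
proof -
  obtain X where X: "X \<in> compact_metrics" "c = isometry_rel `` {X}"
    using assms by (auto simp: gh_space_def elim: quotientE)
  have "X \<in> c"
    using X by (simp add: isometry_rel_def isometric_refl)
  then show r: "class_rep c \<in> c"
    unfolding class_rep_def by (rule someI)
  then have XR: "(X, class_rep c) \<in> isometry_rel"
    using X by simp
  then show "class_rep c \<in> compact_metrics"
    by (simp add: isometry_rel_def)
  show "isometry_rel `` {class_rep c} = c"
    using equiv_class_eq[OF equiv_isometry_rel XR] X(2) by simp
qed

lemma gh_dist_class_rep:
  assumes "c \<in> gh_space" "c' \<in> gh_space"
  shows "gh_dist c c' = gh_distance (class_rep c) (class_rep c')"
  using gh_dist_class[OF class_rep_gh_space(2)[OF assms(1)] class_rep_gh_space(2)[OF assms(2)]]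
  unfolding class_rep_gh_space(3)[OF assms(1)] class_rep_gh_space(3)[OF assms(2)] .

lemma gh_dist_nonneg:
  assumes "c \<in> gh_space" "c' \<in> gh_space"
  shows "0 \<le> gh_dist c c'"
  unfolding gh_dist_class_rep[OF assms]
  using assms by (intro gh_distance_nonneg compact_metrics_bounded class_rep_gh_space(2))

text \<open>The index \<open>(c, x)\<close> stands for a chosen section through \<open>x\<close> at
  \<open>c\<close>. Hence evaluation at each terminal is onto, while at other vertices it may miss
  points. Passing to a spanning tree makes the sections available and does not increase the
  length.\<close>

lemma graph_connects_pseudometrics:
  assumes M: "M \<subseteq> gh_space" "M \<noteq> {}" "finite M" "\<And>c. c \<in> M \<Longrightarrow> finite (mspace (class_rep c))"
    and G: "graph_connects gh_space M G" and r: "r \<in> M" and e: "e > 0"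
  defines "I \<equiv> Sigma M (\<lambda>c. mspace (class_rep c))"
  obtains V E \<phi> where "rooted_tree r V E" "M \<subseteq> V" "\<phi> ` V \<subseteq> pseudometrics I"
    "\<And>c. c \<in> M \<Longrightarrow> \<exists>g. g ` I = mspace (class_rep c) \<and> \<phi> c = pullback_metric I (class_rep c) g"
    "(\<Sum>a\<in>E. edge_length (\<lambda>u v. half_sup_dist I (\<phi> u) (\<phi> v)) a) \<le> graph_length gh_dist G + e"
proof -
  have compact: "bounded_metric (class_rep c)" if "c \<in> gh_space" for c
    using compact_metrics_bounded class_rep_gh_space(2)[OF that] .
  obtain V F where VF: "G = (V, F)" by force
  have V: "finite V" "V \<subseteq> gh_space" "\<And>a. a \<in> F \<Longrightarrow> a \<subseteq> V \<and> card a = 2" "M \<subseteq> V"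
    "connected_graph (V, F)"
    using G by (auto simp: graph_connects_def graph_on_def VF)
  have "r \<in> V"
    using r V(4) by blast
  moreover have "\<forall>a\<in>F. a \<subseteq> V"
    using V(3) by blast
  ultimately obtain E where E: "E \<subseteq> F" "rooted_tree r V E"
    using spanning_rooted_tree[OF V(1) V(5)] by blast
  have finF: "finite F"
    using V(1,3) by (meson finite_Pow_iff finite_subset PowI subsetI)
  then have finE: "finite E"
    using E(1) finite_subset by blast
  \<comment> \<open>The error \<open>e\<close> is spread over the edges; adding 1 avoids a zero
    denominator for a tree without edges.\<close>
  define \<epsilon> where "\<epsilon> = e / (real (card E) + 1)"
  have \<epsilon>: "\<epsilon> > 0" "real (card E) * \<epsilon> \<le> e"
    using e by (auto simp: \<epsilon>_def field_simps)
  define D where "D u v = gh_dist u v + \<epsilon>" for u v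
  have "gh_distance (class_rep u) (class_rep v) < D u v" if "u \<in> V" "v \<in> V" for u v
    using gh_dist_class_rep[of u v] that V(2) \<epsilon>(1) unfolding D_def by (simp add: subset_iff)
  moreover have "D u v = D v u" for u v
    by (simp add: D_def gh_dist_commute)
  moreover have "bounded_metric (class_rep u)" if "u \<in> V" for u
    using compact that V(2) by blast
  ultimately obtain \<Sigma> where "tree_sections class_rep D V E \<Sigma>"
    using rooted_tree_sections[OF E(2), of class_rep D] by blast
  then have \<Sigma>: "\<And>s u. s \<in> \<Sigma> \<Longrightarrow> u \<in> V \<Longrightarrow> s u \<in> mspace (class_rep u)"
    "\<And>u x. u \<in> V \<Longrightarrow> x \<in> mspace (class_rep u) \<Longrightarrow> \<exists>s\<in>\<Sigma>. s u = x"
    "\<And>u v s t. {u, v} \<in> E \<Longrightarrow> s \<in> \<Sigma> \<Longrightarrow> t \<in> \<Sigma> \<Longrightarrow>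
      \<bar>mdist (class_rep u) (s u) (t u) - mdist (class_rep v) (s v) (t v)\<bar> \<le> 2 * D u v"
    unfolding tree_sections_def by simp_all
  have "\<forall>i\<in>I. \<exists>s. s \<in> \<Sigma> \<and> s (fst i) = snd i"
    using \<Sigma>(2) V(4) by (fastforce simp: I_def)
  then obtain S where S: "\<And>i. i \<in> I \<Longrightarrow> S i \<in> \<Sigma>" "\<And>i. i \<in> I \<Longrightarrow> S i (fst i) = snd i"
    by metis
  define \<phi> where "\<phi> u = pullback_metric I (class_rep u) (\<lambda>i. S i u)" for u
  have I: "finite I" "I \<noteq> {}"
  proof -
    show "finite I"
      using M by (simp add: I_def)
    have "mspace (class_rep r) \<noteq> {}"
      using compact r M(1) by (auto simp: bounded_metric_def)
    then show "I \<noteq> {}"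
      using r by (auto simp: I_def)
  qed
  show ?thesis
  proof (rule that[OF E(2) V(4)])
    show "\<phi> ` V \<subseteq> pseudometrics I"
    proof
      fix \<rho> assume "\<rho> \<in> \<phi> ` V"
      then obtain u where u: "u \<in> V" "\<rho> = \<phi> u" by blast
      show "\<rho> \<in> pseudometrics I"
        unfolding u(2) \<phi>_def using \<Sigma>(1) S(1) u(1) by (intro pullback_metric_pseudometrics) blast
    qed
    show "\<exists>g. g ` I = mspace (class_rep c) \<and> \<phi> c = pullback_metric I (class_rep c) g" if c: "c \<in> M" for c
    proof (intro exI[of _ "\<lambda>i. S i c"] conjI)
      show "(\<lambda>i. S i c) ` I = mspace (class_rep c)"
      proof
        show "(\<lambda>i. S i c) ` I \<subseteq> mspace (class_rep c)"
          using \<Sigma>(1) S(1) c V(4) by blast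
        show "mspace (class_rep c) \<subseteq> (\<lambda>i. S i c) ` I"
        proof
          fix x assume "x \<in> mspace (class_rep c)"
          then have i: "(c, x) \<in> I"
            using c by (simp add: I_def)
          show "x \<in> (\<lambda>i. S i c) ` I"
            using S(2)[OF i] by (intro image_eqI[OF _ i]) simp
        qed
      qed
    qed (simp add: \<phi>_def)
    have le: "edge_length (\<lambda>u v. half_sup_dist I (\<phi> u) (\<phi> v)) a \<le> edge_length gh_dist a + \<epsilon>"
      if a: "a \<in> E" for a
    proof -
      have "card a = 2"
        using V(3) a E(1) by blast
      then obtain u v where uv: "a = {u, v}"
        unfolding card_2_iff by blast
      have "half_sup_dist I (\<phi> u) (\<phi> v) \<le> D u v"
        unfolding half_sup_dist_le_iff[OF I]
      proof
        fix z assume "z \<in> I \<times> I"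
        then obtain i j where z: "z = (i, j)" "i \<in> I" "j \<in> I" by blast
        show "\<bar>\<phi> u z - \<phi> v z\<bar> \<le> 2 * D u v"
          using \<Sigma>(3)[OF _ S(1)[OF z(2)] S(1)[OF z(3)], of u v] a z
          by (simp add: \<phi>_def pullback_metric_apply uv)
      qed
      moreover have "half_sup_dist I x y = half_sup_dist I y x" for x y
        by (simp add: half_sup_dist_def abs_minus_commute)
      ultimately show ?thesis
        by (simp add: uv edge_length_pair gh_dist_commute D_def)
    qed
    have nn: "0 \<le> edge_length gh_dist a" if a: "a \<in> F" for a
    proof -
      have "card a = 2" "a \<subseteq> gh_space"
        using V(2,3) a by blast+
      then obtain u v where uv: "a = {u, v}" "u \<in> gh_space" "v \<in> gh_space"
        unfolding card_2_iff by blast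
      then show ?thesis
        using gh_dist_nonneg by (simp add: edge_length_pair[OF gh_dist_commute])
    qed
    have "(\<Sum>a\<in>E. edge_length (\<lambda>u v. half_sup_dist I (\<phi> u) (\<phi> v)) a) \<le>
        (\<Sum>a\<in>E. edge_length gh_dist a + \<epsilon>)"
      using le by (rule sum_mono)
    also have "\<dots> = (\<Sum>a\<in>E. edge_length gh_dist a) + real (card E) * \<epsilon>"
      by (simp add: sum.distrib)
    also have "\<dots> \<le> (\<Sum>a\<in>F. edge_length gh_dist a) + e"
      using sum_mono2[OF finF E(1), of "edge_length gh_dist"] nn \<epsilon>(2) by (intro add_mono) auto
    also have "\<dots> = graph_length gh_dist G + e"
      by (simp add: graph_length_def VF)
    finally show "(\<Sum>a\<in>E. edge_length (\<lambda>u v. half_sup_dist I (\<phi> u) (\<phi> v)) a) \<le>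
        graph_length gh_dist G + e" .
  qed
qed

section \<open>Minimizing over all positions of the terminals\<close>

theorem theorem2p1:
  fixes n :: nat and M :: "real metric set set"
  assumes "n \<ge> 1"
    and "M \<subseteq> gh_space_le n" and "finite M" and "M \<noteq> {}"
  shows "SMT gh_space gh_dist M \<noteq> {}"
proof -
  have M: "M \<subseteq> gh_space"
    using assms(2) by (auto simp: gh_space_le_def)
  have fin: "finite (mspace (class_rep c))" if "c \<in> M" for c
    using assms(2) that class_rep_gh_space(1)[of c] by (auto simp: gh_space_le_def)
  have ne: "mspace (class_rep c) \<noteq> {}" if "c \<in> M" for c
    using class_rep_gh_space(2)[of c] that M by (auto simp: compact_metrics_def)
  obtain r where r: "r \<in> M"
    using assms(4) by blast
  define I where "I = Sigma M (\<lambda>c. mspace (class_rep c))"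
  have I: "finite I" "I \<noteq> {}"
  proof -
    show "finite I"
      using assms(3) fin by (simp add: I_def)
    show "I \<noteq> {}"
      using r ne[OF r] by (auto simp: I_def)
  qed
  interpret proper_space "pseudometrics I" "half_sup_dist I"
    using proper_space_pseudometrics[OF I] .
  \<comment> \<open>The possible positions of the terminal \<open>c\<close>. Taking extensional
    functions makes the set of surjections finite.\<close>
  define \<P> where "\<P> c = pullback_metric I (class_rep c) `
      {g \<in> I \<rightarrow>\<^sub>E mspace (class_rep c). g ` I = mspace (class_rep c)}" for c
  have \<P>I: "pullback_metric I (class_rep c) g \<in> \<P> c" if g: "g ` I = mspace (class_rep c)" for c g
  proof -
    have "restrict g I \<in> {g \<in> I \<rightarrow>\<^sub>E mspace (class_rep c). g ` I = mspace (class_rep c)}"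
      using g by auto
    moreover have "pullback_metric I (class_rep c) g = pullback_metric I (class_rep c) (restrict g I)"
      by (rule pullback_metric_cong) simp
    ultimately show ?thesis
      unfolding \<P>_def by blast
  qed
  \<comment> \<open>Simultaneous choices of a position for every terminal, each posing one Steiner
    problem among pseudometrics.\<close>
  define \<Q> where "\<Q> = PiE M \<P>"
  have "finite (\<P> c)" if "c \<in> M" for c
    unfolding \<P>_def using I(1) fin[OF that] by (intro finite_imageI finite_Collect_conjI disjI1) (simp add: finite_PiE)
  then have finQ: "finite \<Q>"
    unfolding \<Q>_def using assms(3) by (intro finite_PiE)
  have "\<P> c \<noteq> {}" if c: "c \<in> M" for c
  proof -
    obtain x where x: "x \<in> mspace (class_rep c)"
      using ne[OF c] by blast
    \<comment> \<open>The indices over \<open>c\<close> already cover the space; the others are sent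
      to the arbitrary point \<open>x\<close>.\<close>
    define g where "g i = (if fst i = c then snd i else x)" for i
    have "g ` I = mspace (class_rep c)"
    proof
      show "g ` I \<subseteq> mspace (class_rep c)"
        using x by (auto simp: g_def I_def)
      show "mspace (class_rep c) \<subseteq> g ` I"
      proof
        fix y assume "y \<in> mspace (class_rep c)"
        then have "(c, y) \<in> I"
          using c by (simp add: I_def)
        then show "y \<in> g ` I"
          by (rule rev_image_eqI) (simp add: g_def)
      qed
    qed
    then show ?thesis
      using \<P>I by blast
  qed
  then have neQ: "\<Q> \<noteq> {}"
    by (simp add: \<Q>_def PiE_eq_empty_iff)
  have p: "p c \<in> pseudometrics I" "quotient_class I (p c) = c" if "p \<in> \<Q>" "c \<in> M" for p c
  proof -
    have "p c \<in> \<P> c"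
      using that by (auto simp: \<Q>_def)
    then obtain g where g: "p c = pullback_metric I (class_rep c) g" "g ` I = mspace (class_rep c)"
      unfolding \<P>_def by blast
    have c: "c \<in> gh_space"
      using that(2) M by blast
    show "p c \<in> pseudometrics I"
      unfolding g(1) using g(2) by (intro pullback_metric_pseudometrics) simp
    show "quotient_class I (p c) = c"
      unfolding g(1) using quotient_class_pullback[OF I class_rep_gh_space(2)[OF c] g(2)]
      by (simp add: class_rep_gh_space(3)[OF c])
  qed
  \<comment> \<open>The root is held at the terminal \<open>r\<close>, where every competing tree
    can be rooted as well, so its position is not a further variable.\<close>
  have "\<forall>p\<in>\<Q>. \<exists>c. steiner_cost p M (p r) c \<and> (\<forall>c'. steiner_cost p M (p r) c' \<longrightarrow> c \<le> c')"
    using p(1) r by (intro ballI steiner_cost_minimum assms(3)) auto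
  then obtain m where m: "\<And>p. p \<in> \<Q> \<Longrightarrow> steiner_cost p M (p r) (m p)"
    "\<And>p c. p \<in> \<Q> \<Longrightarrow> steiner_cost p M (p r) c \<Longrightarrow> m p \<le> c"
    by metis
  define p0 where "p0 = arg_min_on m \<Q>"
  have p0: "p0 \<in> \<Q>" "\<And>p. p \<in> \<Q> \<Longrightarrow> m p0 \<le> m p"
    using arg_min_if_finite(1)[OF finQ neQ] arg_min_least[OF finQ neQ] by (simp_all add: p0_def)
  have "\<exists>G. graph_connects gh_space
      (insert (quotient_class I (p0 r)) (quotient_class I ` p0 ` M)) G \<and> graph_length gh_dist G \<le> m p0"
    using m(1)[OF p0(1)]
  proof (rule steiner_cost_graph)
    show "gh_dist x y = gh_dist y x" for x y
      by (rule gh_dist_commute)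
  qed (use quotient_class_gh_space[OF I] gh_dist_quotient_class_le[OF I] gh_dist_nonneg in blast)+
  then obtain G0 where G0: "graph_connects gh_space M G0" "graph_length gh_dist G0 \<le> m p0"
    using p(2)[OF p0(1)] r by (auto simp: image_image insert_absorb)
  \<comment> \<open>A competitor lifts, up to \<open>e\<close>, to a tree for some position in
    \<open>\<Q>\<close>, whose cost is at least the overall minimum \<open>m p0\<close>.\<close>
  have lower: "m p0 \<le> graph_length gh_dist G" if G: "graph_connects gh_space M G" for G
  proof (rule field_le_epsilon)
    fix e :: real assume e: "e > 0"
    obtain V E \<phi> where V: "rooted_tree r V E" "M \<subseteq> V" "\<phi> ` V \<subseteq> pseudometrics I"
      and \<phi>: "\<And>c. c \<in> M \<Longrightarrow> \<exists>g. g ` I = mspace (class_rep c) \<and> \<phi> c = pullback_metric I (class_rep c) g"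
      and len: "(\<Sum>a\<in>E. edge_length (\<lambda>u v. half_sup_dist I (\<phi> u) (\<phi> v)) a) \<le> graph_length gh_dist G + e"
      using graph_connects_pseudometrics[OF M assms(4,3) fin G r e] unfolding I_def by blast
    have p: "restrict \<phi> M \<in> \<Q>"
      unfolding \<Q>_def restrict_PiE_iff
    proof
      fix c assume "c \<in> M"
      then show "\<phi> c \<in> \<P> c"
        using \<phi> \<P>I by metis
    qed
    obtain k where k: "steiner_cost (restrict \<phi> M) (M \<inter> V) (\<phi> r) k"
      "k \<le> (\<Sum>a\<in>E. edge_length (\<lambda>u v. half_sup_dist I (\<phi> u) (\<phi> v)) a)"
      using steiner_cost_le_tree[OF V(1,3), of M "restrict \<phi> M"] by auto
    have "M \<inter> V = M" "restrict \<phi> M r = \<phi> r"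
      using V(2) r by auto
    then have "m (restrict \<phi> M) \<le> k"
      using m(2)[OF p] k(1) by simp
    then show "m p0 \<le> graph_length gh_dist G + e"
      using p0(2)[OF p] k(2) len by linarith
  qed
  have "smt gh_space gh_dist M = graph_length gh_dist G0"
    unfolding smt_def
  proof (rule cInf_eq_minimum)
    show "graph_length gh_dist G0 \<in> {graph_length gh_dist G |G. graph_connects gh_space M G}"
      using G0(1) by blast
    show "graph_length gh_dist G0 \<le> x"
      if "x \<in> {graph_length gh_dist G |G. graph_connects gh_space M G}" for x
      using that lower G0(2) by fastforce
  qed
  then show ?thesis
    using G0(1) unfolding SMT_def by (metis (mono_tags, lifting) empty_iff mem_Collect_eq)
qed

end
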